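(* For every $n\geq 1$, the map $\Phi_2$ is a bijection between permutations of $\{1,\ldots,n\}$ and tree-like tableaux of size $n$, and it satisfies $tree(\sigma)=tree(\Phi_2(\sigma))$ for every permutation $\sigma$.
   Context: A Ferrers diagram is a finite set of unit cells of $\mathbb{Z}^2$ forming left-justified rows whose lengths weakly decrease from top to bottom, considered up to translation; its boundary edges are the unit edges on its Southeast border path, ordered Southwest to Northeast. A tree-like tableau is a Ferrers diagram in which each cell is empty or pointed, such that: (1) the top-left cell is pointed (root point); (2) every non-root pointed cell has either a pointed cell above it in its column or a pointed cell to its left in its row, but not both; (3) every row and column contains a pointed cell. Its size $n$ is its number of points (half-perimeter minus 1). The special point of $T$ is the rightmost among pointed cells that are lowest in their column. $\mathrm{Insertpoint}(T,e)$ for a boundary edge $e$: let $T'$ be obtained by inserting at $e$ a column (if $e$ is the right end of a row $r$: add a cell at the end of $r$ and every row above) or a row (if $e$ is the bottom of a column $c$: add a cell at the bottom of $c$ and every column to its left), with only the lowest cell of the new column (resp. rightmost cell of the new row) pointed. If $e$ lies Northeast of the special point of $T$ along the border path, the result is $T'$; otherwise add the ribbon of empty cells (connected, no $2\times2$ square, keeping a Ferrers diagram) from the cell immediately right of the new point to the cell immediately below the special point of $T$ (nothing if $e$ is the bottom edge of the special cell). A planar binary tree is a rooted tree in which every vertex has either no children (leaf) or an ordered pair (left, right) of children (node); its size is its number of nodes, and its leaves are ordered left to right. $tree(T)$ for a tree-like tableau $T$: nodes are the pointed cells, the root is the root point; the left child of a point $p$ is the nearest pointed cell below $p$ in its column,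 or if none the leaf given by the boundary edge at the bottom of that column; the right child of $p$ is the nearest pointed cell to the right of $p$ in its row, or if none the leaf given by the boundary edge at the end of that row. An increasing tree of size $n$ is a binary tree of size $n$ whose nodes are labelled bijectively by $1,\ldots,n$ with labels increasing along paths from the root. $inctree(\sigma)$ for a permutation $\sigma=\sigma_1\cdots\sigma_n$ is the unique increasing tree whose inorder traversal (left subtree, root, right subtree) reads $\sigma_1,\ldots,\sigma_n$; $tree(\sigma)$ is $inctree(\sigma)$ with labels forgotten. $\Phi_2$ is defined by induction: $\Phi_2(1)$ is the unique tableau of size 1. For $\sigma$ a permutation of $\{1,\ldots,n+1\}$ with $n+1$ in position $p$, let $\tau$ be $\sigma$ with $n+1$ deleted (so $inctree(\sigma)$ is obtained from $inctree(\tau)$ by replacing its $p$-th leaf $L$ from the left by a node labelled $n+1$ with two leaves). Let $e_L$ be the boundary edge of $\Phi_2(\tau)$ which is the $p$-th leaf from the left of $tree(\Phi_2(\tau))$, and set $\Phi_2(\sigma)=\mathrm{Insertpoint}(\Phi_2(\tau),e_L)$. *)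

theory Defs
  imports "HOL-Library.Tree" "HOL-Combinatorics.Multiset_Permutations"
begin

(* A cell is (row, column), rows counted downwards and columns rightwards from 0.
   Diagrams "up to translation" are represented by the translate in matrix coordinates
   whose top-left cell is (0, 0). *)

type_synonym cell = "nat \<times> nat"

datatype tableau = Tableau (cells: "cell set") (points: "cell set")

definition row_len :: "cell set \<Rightarrow> nat \<Rightarrow> nat" where
  "row_len D i = card {j. (i, j) \<in> D}"

definition col_height :: "cell set \<Rightarrow> nat \<Rightarrow> nat" where
  "col_height D j = card {i. (i, j) \<in> D}"

definition ferrers :: "cell set \<Rightarrow> bool" where
  "ferrers D \<longleftrightarrow> finite D \<and> (\<forall>i. {j. (i, j) \<in> D} = {..<row_len D i}) \<and> antimono (row_len D)"

definition tree_like_tableau :: "tableau \<Rightarrow> bool" where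
  "tree_like_tableau T \<longleftrightarrow>
     ferrers (cells T) \<and> points T \<subseteq> cells T \<and>
     (0, 0) \<in> points T \<and>
     (\<forall>(i, j) \<in> points T - {(0, 0)}.
        (\<exists>i'<i. (i', j) \<in> points T) \<noteq> (\<exists>j'<j. (i, j') \<in> points T)) \<and>
     (\<forall>i. (\<exists>j. (i, j) \<in> cells T) \<longrightarrow> (\<exists>j. (i, j) \<in> points T)) \<and>
     (\<forall>j. (\<exists>i. (i, j) \<in> cells T) \<longrightarrow> (\<exists>i. (i, j) \<in> points T))"

definition tableau_size :: "tableau \<Rightarrow> nat" where
  "tableau_size T = card (points T)"


(* Boundary edges: the right end of a row, or the bottom of a column. *)

datatype edge = RowEnd nat | ColBottom nat

(* Seen from Southwest to Northeast, the edge "RowEnd r" starts at x = row_len D r and at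
   depth r + 1, and "ColBottom c" starts at x = c and at depth col_height D c.  Each step
   along the border increases x - depth by one, so this number orders the boundary edges
   from Southwest to Northeast. *)

fun edge_pos :: "cell set \<Rightarrow> edge \<Rightarrow> int" where
  "edge_pos D (RowEnd r) = int (row_len D r) - int (Suc r)"
| "edge_pos D (ColBottom c) = int c - int (col_height D c)"

definition special_point :: "tableau \<Rightarrow> cell" where
  "special_point T =
     (ARG_MAX snd p. p \<in> points T \<and> (Suc (fst p), snd p) \<notin> cells T)"


(* Inserting a column at "RowEnd r" or a row at "ColBottom c": the position of the cells of
   the old diagram, the added cells, and the new point. *)

fun shift_cell :: "cell set \<Rightarrow> edge \<Rightarrow> cell \<Rightarrow> cell" where
  "shift_cell D (RowEnd r) (i, j) = (i, if j < row_len D r then j else Suc j)"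
| "shift_cell D (ColBottom c) (i, j) = (if i < col_height D c then i else Suc i, j)"

fun new_cells :: "cell set \<Rightarrow> edge \<Rightarrow> cell set" where
  "new_cells D (RowEnd r) = {(i, row_len D r) | i. i \<le> r}"
| "new_cells D (ColBottom c) = {(col_height D c, j) | j. j \<le> c}"

fun new_point :: "cell set \<Rightarrow> edge \<Rightarrow> cell" where
  "new_point D (RowEnd r) = (r, row_len D r)"
| "new_point D (ColBottom c) = (col_height D c, c)"

definition insert_line :: "tableau \<Rightarrow> edge \<Rightarrow> tableau" where
  "insert_line T e =
     Tableau (shift_cell (cells T) e ` cells T \<union> new_cells (cells T) e)
             (insert (new_point (cells T) e) (shift_cell (cells T) e ` points T))"


definition adjacent :: "cell \<Rightarrow> cell \<Rightarrow> bool" where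
  "adjacent p q \<longleftrightarrow>
     (fst p = fst q \<and> (snd q = Suc (snd p) \<or> snd p = Suc (snd q))) \<or>
     (snd p = snd q \<and> (fst q = Suc (fst p) \<or> fst p = Suc (fst q)))"

definition connected_cells :: "cell set \<Rightarrow> bool" where
  "connected_cells R \<longleftrightarrow>
     (\<forall>p\<in>R. \<forall>q\<in>R. (p, q) \<in> {(x, y). x \<in> R \<and> y \<in> R \<and> adjacent x y}\<^sup>*)"

(* R is a ribbon that can be added to D, with Southwest end a and Northeast end b. *)

definition is_ribbon :: "cell set \<Rightarrow> cell \<Rightarrow> cell \<Rightarrow> cell set \<Rightarrow> bool" where
  "is_ribbon D a b R \<longleftrightarrow>
     R \<inter> D = {} \<and> ferrers (D \<union> R) \<and> connected_cells R \<and>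
     \<not> (\<exists>i j. {(i, j), (i, Suc j), (Suc i, j), (Suc i, Suc j)} \<subseteq> R) \<and>
     a \<in> R \<and> b \<in> R \<and> R \<subseteq> {fst b..fst a} \<times> {snd a..snd b}"

definition ribbon :: "cell set \<Rightarrow> cell \<Rightarrow> cell \<Rightarrow> cell set" where
  "ribbon D a b = (THE R. is_ribbon D a b R)"

(* An edge lies Northeast of the special point if it comes after the bottom edge of the
   special cell.  The special point is moved along when the new row or column is inserted. *)

definition insertpoint :: "tableau \<Rightarrow> edge \<Rightarrow> tableau" where
  "insertpoint T e =
     (let T' = insert_line T e;
          special_edge = ColBottom (snd (special_point T));
          (i, j) = new_point (cells T) e;
          (k, l) = shift_cell (cells T) e (special_point T)
      in if edge_pos (cells T) special_edge < edge_pos (cells T) e \<or> e = special_edge then T'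
         else Tableau (cells T' \<union> ribbon (cells T') (i, Suc j) (Suc k, l)) (points T'))"


(* Planar binary trees are trees whose labels are all (). *)

definition forget_labels :: "'a tree \<Rightarrow> unit tree" where
  "forget_labels = map_tree (\<lambda>_. ())"

definition points_below :: "tableau \<Rightarrow> cell \<Rightarrow> nat set" where
  "points_below T p = {i. fst p < i \<and> (i, snd p) \<in> points T}"

definition points_right :: "tableau \<Rightarrow> cell \<Rightarrow> nat set" where
  "points_right T p = {j. snd p < j \<and> (fst p, j) \<in> points T}"

(* The finiteness test only serves termination. *)

function subtree_at :: "tableau \<Rightarrow> cell \<Rightarrow> cell tree" where
  "subtree_at T p =
     (if finite (points T) then
        Node
          (if points_below T p = {} then Leaf
           else subtree_at T (Min (points_below T p), snd p))
          p
          (if points_right T p = {} then Leaf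
           else subtree_at T (fst p, Min (points_right T p)))
      else Leaf)"
  by auto
termination
proof (relation "measure (\<lambda>(T, p). card {x \<in> points T. fst p + snd p < fst x + snd x})")
  have decr: "((T, q), T, p)
        \<in> measure (\<lambda>(T, p). card {x \<in> points T. fst p + snd p < fst x + snd x})"
    if "finite (points T)" "q \<in> points T" "fst p + snd p < fst q + snd q" for T p q
  proof -
    have "{x \<in> points T. fst q + snd q < fst x + snd x}
          \<subset> {x \<in> points T. fst p + snd p < fst x + snd x}"
    proof (rule psubsetI)
      show "{x \<in> points T. fst q + snd q < fst x + snd x}
            \<subseteq> {x \<in> points T. fst p + snd p < fst x + snd x}"
        using that(3) by auto
      show "{x \<in> points T. fst q + snd q < fst x + snd x}
            \<noteq> {x \<in> points T. fst p + snd p < fst x + snd x}"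
        using that(2,3) by (metis (mono_tags, lifting) less_irrefl mem_Collect_eq)
    qed
    with that(1) show ?thesis by (simp add: psubset_card_mono)
  qed
  fix T p
  assume fin: "finite (points T)"
  show "((T, Min (points_below T p), snd p), T, p)
          \<in> measure (\<lambda>(T, p). card {x \<in> points T. fst p + snd p < fst x + snd x})"
    if ne: "points_below T p \<noteq> {}"
  proof (rule decr)
    have "points_below T p \<subseteq> fst ` points T"
      by (force simp: points_below_def)
    then have "Min (points_below T p) \<in> points_below T p"
      using fin ne by (meson Min_in finite_imageI finite_subset)
    then show "(Min (points_below T p), snd p) \<in> points T"
      and "fst p + snd p < fst (Min (points_below T p), snd p) + snd (Min (points_below T p), snd p)"
      by (auto simp: points_below_def)
  qed (rule fin)
  show "((T, fst p, Min (points_right T p)), T, p)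
          \<in> measure (\<lambda>(T, p). card {x \<in> points T. fst p + snd p < fst x + snd x})"
    if ne: "points_right T p \<noteq> {}"
  proof (rule decr)
    have "points_right T p \<subseteq> snd ` points T"
      by (force simp: points_right_def)
    then have "Min (points_right T p) \<in> points_right T p"
      using fin ne by (meson Min_in finite_imageI finite_subset)
    then show "(fst p, Min (points_right T p)) \<in> points T"
      and "fst p + snd p < fst (fst p, Min (points_right T p)) + snd (fst p, Min (points_right T p))"
      by (auto simp: points_right_def)
  qed (rule fin)
qed simp

declare subtree_at.simps [simp del]

definition tableau_point_tree :: "tableau \<Rightarrow> cell tree" where
  "tableau_point_tree T = subtree_at T (0, 0)"

definition tableau_tree :: "tableau \<Rightarrow> unit tree" where
  "tableau_tree T = forget_labels (tableau_point_tree T)"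

(* The boundary edges that are the leaves of a tree of points, from left to right. *)

fun leaf_edges :: "cell tree \<Rightarrow> edge list" where
  "leaf_edges Leaf = []"
| "leaf_edges (Node l p r) =
     (if l = Leaf then [ColBottom (snd p)] else leaf_edges l) @
     (if r = Leaf then [RowEnd (fst p)] else leaf_edges r)"


(* Permutations of {1..n} are the words in permutations_of_set {1..n}. *)

definition increasing_tree :: "nat \<Rightarrow> nat tree \<Rightarrow> bool" where
  "increasing_tree n t \<longleftrightarrow>
     size t = n \<and> distinct (inorder t) \<and> set_tree t = {1..n} \<and> heap t"

definition inctree :: "nat list \<Rightarrow> nat tree" where
  "inctree \<sigma> = (THE t. increasing_tree (length \<sigma>) t \<and> inorder t = \<sigma>)"

definition perm_tree :: "nat list \<Rightarrow> unit tree" where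
  "perm_tree \<sigma> = forget_labels (inctree \<sigma>)"


(* The largest letter m is in (0-based) position p of \<sigma>, so it is inserted at the leaf
   with 0-based index p. *)

function Phi2 :: "nat list \<Rightarrow> tableau" where
  "Phi2 \<sigma> =
     (if length \<sigma> \<le> 1 then Tableau {(0, 0)} {(0, 0)}
      else let m = Max (set \<sigma>);
               p = length (takeWhile (\<lambda>x. x \<noteq> m) \<sigma>);
               T = Phi2 (remove1 m \<sigma>)
           in insertpoint T (leaf_edges (tableau_point_tree T) ! p))"
  by auto
termination
proof (relation "measure length")
  fix \<sigma> :: "nat list" and m
  assume "\<not> length \<sigma> \<le> 1" and m: "m = Max (set \<sigma>)"
  then have "\<sigma> \<noteq> []" "m \<in> set \<sigma>" by (auto intro!: Max_in)
  then show "(remove1 m \<sigma>, \<sigma>) \<in> measure length"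
    by (simp add: length_remove1)
qed simp

declare Phi2.simps [simp del]

end

(* The key point is that Insertpoint is a bijection from pairs (T, e), with e a boundary edge of T,
   onto the tableaux with one more point.  It is a composition of two bijections.  Inserting a row
   or a column turns (T, e) into a tableau T' with a marked pointed corner p, and the kind of line
   inserted can be read off from T': it is a column iff p has a point to its left.  Then e lies
   Northeast of the special point of T iff p is the special point of T'; otherwise the ribbon is
   added from p to the special point of T'.  Either way p becomes the special point of the result,
   so p is recovered from the result alone, and the ribbon, if any, is the piece of the rim that
   starts right of p and ends at the first cell lying below a point.
   On trees, inserting at e replaces the leaf e by a node with two leaves, exactly as inserting the
   largest letter does in the increasing tree. *)

theory Submission
  imports Defs
begin

section \<open>Inserting a row or a column\<close>

text \<open>Why \<open>p\<close> becomes special: the ribbon puts a cell below every point right of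
  \<open>p\<close> that was the bottom of its column, and further right than the old special point
  there is no such point. Why the end of the ribbon can be found again: between the row of the old
  special point and that of \<open>p\<close>, every old cell has its southeast neighbour in the
  enlarged diagram, so no point there can pass for the end. For the bijection with permutations,
  pairs of a tableau and a boundary edge must match pairs of a word and a position. This uses that
  each boundary edge occurs exactly once among the leaves of the tree. The tree is computed from the
  points alone, and edges are named by a row or column index and not by a place on the border. A
  ribbon has no points, so it changes neither the tree nor the names of its leaves.\<close>

lemma ferrersD:
  assumes "ferrers D"
  shows "finite D" and "(i, j) \<in> D \<longleftrightarrow> j < row_len D i" and "antimono (row_len D)"
  using assms unfolding ferrers_def by blast+

lemma ferrers_down:
  assumes "ferrers D" "(i, j) \<in> D" "i' \<le> i" "j' \<le> j"
  shows "(i', j') \<in> D"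
  using assms(2-4) ferrersD(2)[OF assms(1)] antimonoD[OF ferrersD(3)[OF assms(1)], of i' i]
  by (meson le_less_trans less_le_trans)

lemma card_lessThan_iff:
  assumes "\<And>j. P j \<longleftrightarrow> j < m"
  shows "card {j. P j} = (m::nat)"
  using assms by (simp flip: lessThan_def)

lemma row_len_eqI: "(\<And>j. (i, j) \<in> D \<longleftrightarrow> j < m) \<Longrightarrow> row_len D i = m"
  unfolding row_len_def by (rule card_lessThan_iff)

lemma col_height_eqI: "(\<And>i. (i, j) \<in> D \<longleftrightarrow> i < m) \<Longrightarrow> col_height D j = m"
  unfolding col_height_def by (rule card_lessThan_iff)

lemma finite_down_nat:
  assumes "finite A" "\<And>x y. x \<in> A \<Longrightarrow> y \<le> x \<Longrightarrow> y \<in> A"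
  shows "\<exists>m::nat. \<forall>x. x \<in> A \<longleftrightarrow> x < m"
proof (intro exI allI)
  show "x \<in> A \<longleftrightarrow> x < (LEAST m. m \<notin> A)" for x
  proof
    obtain m where "m \<notin> A"
      using assms(1) infinite_UNIV_nat by (metis ex_new_if_finite)
    then have *: "(LEAST m. m \<notin> A) \<notin> A" by (rule LeastI)
    show "x \<in> A \<Longrightarrow> x < (LEAST m. m \<notin> A)"
      using * assms(2) not_less by blast
    show "x < (LEAST m. m \<notin> A) \<Longrightarrow> x \<in> A"
      using not_less_Least by blast
  qed
qed

lemma down_closed_row:
  assumes "finite D" "\<And>i j i' j'. (i, j) \<in> D \<Longrightarrow> i' \<le> i \<Longrightarrow> j' \<le> j \<Longrightarrow> (i', j') \<in> D"
  shows "(i, j) \<in> D \<longleftrightarrow> j < row_len D i"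
proof -
  have "finite {j. (i, j) \<in> D}"
    using finite_vimageI[OF assms(1), of "Pair i"] by (simp add: vimage_def inj_on_def)
  then obtain m where "\<forall>j. (i, j) \<in> D \<longleftrightarrow> j < m"
    using finite_down_nat[of "{j. (i, j) \<in> D}"] assms(2) by blast
  then show ?thesis using row_len_eqI[of i D m] by simp
qed

text \<open>The diagrams built later are known through the membership of their cells, so closure
  under moving up and left is the form in which the Ferrers condition gets checked.\<close>

lemma ferrersI:
  assumes "finite D" "\<And>i j i' j'. (i, j) \<in> D \<Longrightarrow> i' \<le> i \<Longrightarrow> j' \<le> j \<Longrightarrow> (i', j') \<in> D"
  shows "ferrers D"
proof -
  have row: "(i, j) \<in> D \<longleftrightarrow> j < row_len D i" for i j
    by (rule down_closed_row[OF assms])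
  have "{j. (i, j) \<in> D} = {..<row_len D i}" for i
    by (simp add: row lessThan_def)
  moreover have "row_len D i' \<le> row_len D i" if "i \<le> i'" for i i'
  proof (rule ccontr)
    assume "\<not> row_len D i' \<le> row_len D i"
    then have "(i', row_len D i) \<in> D" by (simp add: row)
    then have "(i, row_len D i) \<in> D" by (rule assms(2)) (use that in auto)
    then show False by (simp add: row)
  qed
  ultimately show ?thesis
    unfolding ferrers_def antimono_def using assms(1) by blast
qed

lemma ferrers_swap: "ferrers D \<Longrightarrow> ferrers (prod.swap ` D)"
  by (rule ferrersI) (auto dest: ferrersD(1) ferrers_down)

lemma mem_swap: "(i, j) \<in> prod.swap ` D \<longleftrightarrow> (j, i) \<in> D"
  by force

lemma row_len_swap: "row_len (prod.swap ` D) i = col_height D i"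
  by (simp add: row_len_def col_height_def mem_swap)

lemma col_height_swap: "col_height (prod.swap ` D) i = row_len D i"
  by (simp add: row_len_def col_height_def mem_swap)

lemma ferrers_mem_col: "ferrers D \<Longrightarrow> (i, j) \<in> D \<longleftrightarrow> i < col_height D j"
  using ferrersD(2)[OF ferrers_swap] by (metis mem_swap row_len_swap)

section \<open>Tree-like tableaux and their transposition\<close>

lemma tltD:
  assumes "tree_like_tableau T"
  shows "ferrers (cells T)" "points T \<subseteq> cells T" "(0, 0) \<in> points T" "finite (points T)"
    and "(i, j) \<in> points T \<Longrightarrow> (i, j) \<noteq> (0, 0) \<Longrightarrow>
           (\<exists>i'<i. (i', j) \<in> points T) \<noteq> (\<exists>j'<j. (i, j') \<in> points T)"
    and "(i, j) \<in> cells T \<Longrightarrow> \<exists>j. (i, j) \<in> points T"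
    and "(i, j) \<in> cells T \<Longrightarrow> \<exists>i. (i, j) \<in> points T"
proof -
  note T = assms[unfolded tree_like_tableau_def]
  show *: "ferrers (cells T)" "points T \<subseteq> cells T" "(0, 0) \<in> points T"
    using T by blast+
  show "finite (points T)"
    using *(2) ferrersD(1)[OF *(1)] by (rule finite_subset)
  show "(\<exists>i'<i. (i', j) \<in> points T) \<noteq> (\<exists>j'<j. (i, j') \<in> points T)"
    if "(i, j) \<in> points T" "(i, j) \<noteq> (0, 0)"
    using bspec[OF T[THEN conjunct2, THEN conjunct2, THEN conjunct2, THEN conjunct1], of "(i, j)"] that
    by simp
  show "\<exists>j. (i, j) \<in> points T" "\<exists>i. (i, j) \<in> points T" if "(i, j) \<in> cells T"
    using T[THEN conjunct2, THEN conjunct2, THEN conjunct2, THEN conjunct2] that by blast+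
qed

lemma tltI:
  assumes "ferrers (cells T)" "points T \<subseteq> cells T" "(0, 0) \<in> points T"
    and "\<And>i j. (i, j) \<in> points T \<Longrightarrow> (i, j) \<noteq> (0, 0) \<Longrightarrow>
           (\<exists>i'<i. (i', j) \<in> points T) \<noteq> (\<exists>j'<j. (i, j') \<in> points T)"
    and "\<And>i j. (i, j) \<in> cells T \<Longrightarrow> \<exists>j. (i, j) \<in> points T"
    and "\<And>i j. (i, j) \<in> cells T \<Longrightarrow> \<exists>i. (i, j) \<in> points T"
  shows "tree_like_tableau T"
  using assms unfolding tree_like_tableau_def by blast

text \<open>Transposition exchanges row and column insertion, so only columns need a direct proof.\<close>

definition flip :: "tableau \<Rightarrow> tableau" where
  "flip T = Tableau (prod.swap ` cells T) (prod.swap ` points T)"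

fun flip_edge :: "edge \<Rightarrow> edge" where
  "flip_edge (RowEnd r) = ColBottom r"
| "flip_edge (ColBottom c) = RowEnd c"

lemma flip_sel [simp]: "cells (flip T) = prod.swap ` cells T" "points (flip T) = prod.swap ` points T"
  by (simp_all add: flip_def)

lemma flip_flip [simp]: "flip (flip T) = T"
  by (cases T) (simp add: flip_def image_image)

lemma tlt_flip:
  assumes "tree_like_tableau T"
  shows "tree_like_tableau (flip T)"
proof (rule tltI)
  note T = tltD[OF assms]
  show "ferrers (cells (flip T))" using T(1) by (simp add: ferrers_swap)
  show "points (flip T) \<subseteq> cells (flip T)" using T(2) by auto
  show "(0, 0) \<in> points (flip T)" using T(3) by (simp add: mem_swap)
  show "(\<exists>i'<i. (i', j) \<in> points (flip T)) \<noteq> (\<exists>j'<j. (i, j') \<in> points (flip T))"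
    if "(i, j) \<in> points (flip T)" "(i, j) \<noteq> (0, 0)" for i j
    using T(5)[of j i] that by (auto simp: mem_swap)
  show "\<exists>j. (i, j) \<in> points (flip T)" "\<exists>i. (i, j) \<in> points (flip T)"
    if "(i, j) \<in> cells (flip T)" for i j
    using T(6,7)[of j i] that by (simp_all add: mem_swap)
qed

lemma new_point_flip: "new_point (prod.swap ` D) (flip_edge e) = prod.swap (new_point D e)"
  by (cases e) (auto simp: row_len_swap col_height_swap)

lemma shift_cell_flip:
  "shift_cell (prod.swap ` D) (flip_edge e) (prod.swap p) = prod.swap (shift_cell D e p)"
  by (cases e; cases p) (auto simp: row_len_swap col_height_swap)

lemma new_cells_flip: "new_cells (prod.swap ` D) (flip_edge e) = prod.swap ` new_cells D e"
  by (cases e) (auto simp: row_len_swap col_height_swap mem_swap)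

lemma insert_line_flip: "insert_line (flip T) (flip_edge e) = flip (insert_line T e)"
  by (simp add: insert_line_def flip_def new_point_flip new_cells_flip image_Un image_image shift_cell_flip)

text \<open>The type \<open>edge\<close> also contains ends of rows and bottoms of columns that do
  not exist; an existing row or column of a Ferrers diagram is recognised by its first cell.\<close>

definition valid_edge :: "cell set \<Rightarrow> edge \<Rightarrow> bool" where
  "valid_edge D e = (case e of RowEnd r \<Rightarrow> (r, 0) \<in> D | ColBottom c \<Rightarrow> (0, c) \<in> D)"

lemma valid_edge_simps [simp]:
  "valid_edge D (RowEnd r) \<longleftrightarrow> (r, 0) \<in> D" "valid_edge D (ColBottom c) \<longleftrightarrow> (0, c) \<in> D"
  by (auto simp: valid_edge_def)

text \<open>What the insertion of a line leaves behind: the marked point from which it can be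
  undone.\<close>

definition corner_point :: "tableau \<Rightarrow> cell \<Rightarrow> bool" where
  "corner_point T p \<longleftrightarrow> p \<in> points T \<and> (Suc (fst p), snd p) \<notin> cells T \<and> (fst p, Suc (snd p)) \<notin> cells T"

lemma corner_point_flip: "corner_point (flip T) (prod.swap p) \<longleftrightarrow> corner_point T p"
  by (cases p) (auto simp: corner_point_def mem_swap)

section \<open>Inserting a line keeps the tableau tree-like\<close>

lemma mem_shift_column:
  "(x, y) \<in> (\<lambda>(i, j). (i, if j < c then j else Suc j)) ` S \<longleftrightarrow>
     y \<noteq> c \<and> (x, if y < c then y else y - 1) \<in> S"
  by (force simp: image_iff split: if_splits)

text \<open>Coordinates are pulled back to \<open>T\<close>, which turns the later arguments into a
  case distinction on \<open>y\<close> against \<open>c\<close>. The subtraction is only reached for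
  \<open>y > c\<close>, so it is never truncated.\<close>

lemma insert_line_row_end:
  fixes T r
  defines "c \<equiv> row_len (cells T) r" and "T' \<equiv> insert_line T (RowEnd r)"
  shows "(x, y) \<in> cells T' \<longleftrightarrow> (if y = c then x \<le> r else (x, if y < c then y else y - 1) \<in> cells T)"
    and "(x, y) \<in> points T' \<longleftrightarrow> (if y = c then x = r else (x, if y < c then y else y - 1) \<in> points T)"
proof -
  have *: "shift_cell (cells T) (RowEnd r) = (\<lambda>(i, j). (i, if j < c then j else Suc j))"
    by (auto simp: c_def)
  show "(x, y) \<in> cells T' \<longleftrightarrow> (if y = c then x \<le> r else (x, if y < c then y else y - 1) \<in> cells T)"
    "(x, y) \<in> points T' \<longleftrightarrow> (if y = c then x = r else (x, if y < c then y else y - 1) \<in> points T)"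
    unfolding T'_def insert_line_def tableau.sel Un_iff insert_iff * mem_shift_column
    by (auto simp: c_def)
qed

lemma insert_line_col_bottom:
  fixes T c
  defines "h \<equiv> col_height (cells T) c" and "T' \<equiv> insert_line T (ColBottom c)"
  shows "(x, y) \<in> cells T' \<longleftrightarrow> (if x = h then y \<le> c else (if x < h then x else x - 1, y) \<in> cells T)"
    and "(x, y) \<in> points T' \<longleftrightarrow> (if x = h then y = c else (if x < h then x else x - 1, y) \<in> points T)"
proof -
  have "insert_line (flip T) (RowEnd c) = flip T'"
    using insert_line_flip[of T "ColBottom c"] by (simp add: T'_def)
  then show "(x, y) \<in> cells T' \<longleftrightarrow> (if x = h then y \<le> c else (if x < h then x else x - 1, y) \<in> cells T)"
    "(x, y) \<in> points T' \<longleftrightarrow> (if x = h then y = c else (if x < h then x else x - 1, y) \<in> points T)"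
    using insert_line_row_end[of y x "flip T" c] by (simp_all add: mem_swap row_len_swap h_def)
qed

lemma insert_line_finite:
  assumes "finite (cells T)"
  shows "finite (cells (insert_line T e))"
proof -
  have "finite (new_cells (cells T) e)" by (cases e) auto
  then show ?thesis using assms by (simp add: insert_line_def)
qed

text \<open>Row \<open>r\<close> has exactly \<open>c\<close> cells, so only rows strictly above it
  have cells that move. The new point sees an old point on its left and none above, and no old point
  gains the new point above it or to its left.\<close>

lemma insert_line_row_end_tlt:
  assumes T: "tree_like_tableau T" and r: "(r, 0) \<in> cells T"
  shows "tree_like_tableau (insert_line T (RowEnd r))"
    and "corner_point (insert_line T (RowEnd r)) (r, row_len (cells T) r)"
proof -
  define c where "c = row_len (cells T) r"
  define T' where "T' = insert_line T (RowEnd r)"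
  note mem = insert_line_row_end[of _ _ T r, folded c_def T'_def]
  note D = tltD[OF T]
  note down = ferrers_down[OF D(1)]
  have rc: "(r, y) \<in> cells T \<longleftrightarrow> y < c" for y
    using ferrersD(2)[OF D(1)] by (simp add: c_def)
  have above: "x < r" if "(x, y) \<in> cells T" "c \<le> y" for x y
    using that down[of x y r c] rc[of c] by force
  have c0: "c > 0" using rc[of 0] r by simp
  have "ferrers (cells T')"
  proof (rule ferrersI)
    show "finite (cells T')"
      unfolding T'_def by (rule insert_line_finite[OF ferrersD(1)[OF D(1)]])
    fix i j i' j'
    assume a: "(i, j) \<in> cells T'" "i' \<le> i" "j' \<le> j"
    consider "j < c" | "j = c" | "j > c" by linarith
    then show "(i', j') \<in> cells T'"
    proof cases
      case 1
      then show ?thesis using a down by (auto simp: mem)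
    next
      case 2
      then show ?thesis using a down[of r j' i' j'] rc[of j'] by (auto simp: mem)
    next
      case 3
      then have *: "(i, j - 1) \<in> cells T" using a by (simp add: mem)
      then have "i < r" using above 3 by simp
      then show ?thesis using a 3 down[OF *, of i'] by (auto simp: mem)
    qed
  qed
  moreover have "points T' \<subseteq> cells T'"
    using D(2) by (auto simp: mem split: if_splits)
  moreover have "(0, 0) \<in> points T'"
    using c0 D(3) by (simp add: mem)
  moreover have "(\<exists>i'<i. (i', j) \<in> points T') \<noteq> (\<exists>j'<j. (i, j') \<in> points T')"
    if p: "(i, j) \<in> points T'" "(i, j) \<noteq> (0, 0)" for i j
  proof (cases "j = c")
    case True
    then have i: "i = r" using p by (simp add: mem)
    \<comment> \<open>Row \<open>r\<close> is nonempty and hence has an old point, which lies left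
      of column \<open>c\<close>; column \<open>c\<close> itself holds only the new point.\<close>
    obtain y where "(r, y) \<in> points T" using D(6)[OF r] by auto
    then have "y < c" "(r, y) \<in> points T'" using rc D(2) by (auto simp: mem)
    then show ?thesis using True i by (auto simp: mem)
  next
    case False
    define j0 where "j0 = (if j < c then j else j - 1)"
    have p0: "(i, j0) \<in> points T" using p False by (simp add: mem j0_def)
    have "(i, j0) \<noteq> (0, 0)" using p c0 False by (auto simp: j0_def split: if_splits)
    from D(5)[OF p0 this]
    have "(\<exists>i'<i. (i', j0) \<in> points T) \<noteq> (\<exists>j'<j0. (i, j') \<in> points T)" .
    moreover have "(\<exists>i'<i. (i', j0) \<in> points T) \<longleftrightarrow> (\<exists>i'<i. (i', j) \<in> points T')"
      using False by (auto simp: mem j0_def)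
    moreover have "(\<exists>j'<j0. (i, j') \<in> points T) \<longleftrightarrow> (\<exists>j'<j. (i, j') \<in> points T')"
    proof
      assume "\<exists>j'<j0. (i, j') \<in> points T"
      then obtain j' where "j' < j0" "(i, j') \<in> points T" by blast
      then have "(i, if j' < c then j' else Suc j') \<in> points T'"
        "(if j' < c then j' else Suc j') < j"
        by (auto simp: mem j0_def split: if_splits)
      then show "\<exists>j'<j. (i, j') \<in> points T'" by blast
    next
      assume "\<exists>j'<j. (i, j') \<in> points T'"
      then obtain j' where j': "j' < j" "(i, j') \<in> points T'" by blast
      \<comment> \<open>Otherwise the shifted old point would be in row \<open>r\<close>, and its
        original column at least \<open>c\<close>, beyond the end of that row.\<close>
      have "j' \<noteq> c"
      proof
        assume "j' = c"
        then have "i = r" "c \<le> j0" using j' by (auto simp: mem j0_def)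
        then show False using above[of i j0] p0 D(2) by auto
      qed
      then have "(i, if j' < c then j' else j' - 1) \<in> points T"
         "(if j' < c then j' else j' - 1) < j0"
        using j' False by (auto simp: mem j0_def)
      then show "\<exists>j'<j0. (i, j') \<in> points T" by blast
    qed
    ultimately show ?thesis by blast
  qed
  moreover have "\<exists>j. (i, j) \<in> points T'" if "(i, j) \<in> cells T'" for i j
  proof -
    have "(i, if j < c then j else j - 1) \<in> cells T"
      using that down[of r "j - 1" i "j - 1"] rc[of "j - 1"] c0 by (auto simp: mem split: if_splits)
    then obtain y where "(i, y) \<in> points T" using D(6) by blast
    then have "(i, if y < c then y else Suc y) \<in> points T'" by (auto simp: mem)
    then show ?thesis by blast
  qed
  moreover have "\<exists>i. (i, j) \<in> points T'" if "(i, j) \<in> cells T'" for i j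
    using that D(7)[of i "if j < c then j else j - 1"] by (auto simp: mem split: if_splits)
  ultimately show "tree_like_tableau (insert_line T (RowEnd r))"
    unfolding T'_def by (rule tltI)
  show "corner_point (insert_line T (RowEnd r)) (r, row_len (cells T) r)"
    unfolding c_def[symmetric] T'_def[symmetric] corner_point_def
    using rc[of c] by (auto simp: mem)
qed

lemma insert_line_tlt:
  assumes T: "tree_like_tableau T" and e: "valid_edge (cells T) e"
  shows "tree_like_tableau (insert_line T e) \<and>
     corner_point (insert_line T e) (new_point (cells T) e)"
proof (cases e)
  case (RowEnd r)
  then show ?thesis using insert_line_row_end_tlt[OF T, of r] e by simp
next
  case (ColBottom c)
  have "(c, 0) \<in> cells (flip T)" using e ColBottom by (simp add: mem_swap)
  from insert_line_row_end_tlt[OF tlt_flip[OF T] this]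
  have "tree_like_tableau (insert_line (flip T) (flip_edge e))"
    "corner_point (insert_line (flip T) (flip_edge e)) (prod.swap (new_point (cells T) e))"
    using ColBottom by (simp_all add: row_len_swap)
  then show ?thesis
    using tlt_flip by (fastforce simp: insert_line_flip corner_point_flip)
qed

section \<open>Undoing the insertion of a line\<close>

definition delete_column :: "nat \<Rightarrow> cell set \<Rightarrow> cell set" where
  "delete_column c S = {(x, y). (x, if y < c then y else Suc y) \<in> S}"

text \<open>Since the corner point has a point to its left, condition (2) allows none above it, and
  no cell lies below it. So column \<open>c\<close> stops at row \<open>r\<close> and has this
  single point, as an inserted column does. The point on the left also keeps row \<open>r\<close>
  from losing its last point.\<close>

lemma insert_line_row_end_inverse:
  assumes "corner_point T' (r, c)" and T': "tree_like_tableau T'"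
    and left: "\<exists>j<c. (r, j) \<in> points T'"
  defines "T \<equiv> Tableau (delete_column c (cells T')) (delete_column c (points T'))"
  shows "tree_like_tableau T" and "(r, 0) \<in> cells T" and "row_len (cells T) r = c"
    and "insert_line T (RowEnd r) = T'"
proof -
  note D = tltD[OF T']
  note down = ferrers_down[OF D(1)]
  have mem: "(x, y) \<in> cells T \<longleftrightarrow> (x, if y < c then y else Suc y) \<in> cells T'"
    "(x, y) \<in> points T \<longleftrightarrow> (x, if y < c then y else Suc y) \<in> points T'" for x y
    by (simp_all add: T_def delete_column_def)
  have p: "(r, c) \<in> points T'" "(r, c) \<in> cells T'" "(Suc r, c) \<notin> cells T'" "(r, Suc c) \<notin> cells T'"
    using assms(1) D(2) by (auto simp: corner_point_def)
  have c0: "c > 0" using left by auto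
  have col: "(x, c) \<in> cells T' \<longleftrightarrow> x \<le> r" for x
    using p down[of r c x c] down[of x c "Suc r" c] by force
  have pc: "(x, c) \<in> points T' \<longleftrightarrow> x = r" for x
  proof
    assume x: "(x, c) \<in> points T'"
    then have "x \<le> r" using D(2) col by auto
    moreover have "\<not> x < r" using D(5)[OF p(1)] c0 left x by blast
    ultimately show "x = r" by simp
  qed (use p in simp)
  have rc: "(r, y) \<in> cells T \<longleftrightarrow> y < c" for y
    using p down[of r c r y] down[of r "Suc y" r "Suc c"] by (auto simp: mem)
  show "row_len (cells T) r = c" by (rule row_len_eqI[OF rc])
  show "(r, 0) \<in> cells T" using rc c0 by simp
  have "cells (insert_line T (RowEnd r)) = cells T'"
    using col by (auto simp: insert_line_row_end \<open>row_len (cells T) r = c\<close> mem split: if_splits)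
  moreover have "points (insert_line T (RowEnd r)) = points T'"
    using pc by (auto simp: insert_line_row_end \<open>row_len (cells T) r = c\<close> mem split: if_splits)
  ultimately show "insert_line T (RowEnd r) = T'" by (simp add: tableau.expand)
  show "tree_like_tableau T"
  proof (rule tltI)
    show "ferrers (cells T)"
    proof (rule ferrersI)
      have "cells T \<subseteq> (\<lambda>(x, y). (x, y)) ` cells T' \<union> (\<lambda>(x, y). (x, y - 1)) ` cells T'"
        by (force simp: mem split: if_splits)
      then show "finite (cells T)"
        using ferrersD(1)[OF D(1)] by (meson finite_UnI finite_imageI finite_subset)
      show "(i', j') \<in> cells T" if "(i, j) \<in> cells T" "i' \<le> i" "j' \<le> j" for i j i' j'
        using that down by (auto simp: mem split: if_splits)
    qed
    show "points T \<subseteq> cells T" using D(2) by (auto simp: mem)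
    show "(0, 0) \<in> points T" using D(3) c0 by (simp add: mem)
    show "\<exists>j. (i, j) \<in> points T" if "(i, j) \<in> cells T" for i j
    proof -
      have "\<exists>y. (i, y) \<in> points T'" using that unfolding mem by (rule D(6))
      then obtain y where y: "(i, y) \<in> points T'" by blast
      obtain y where "(i, y) \<in> points T'" "y \<noteq> c"
      proof (cases "i = r")
        case True
        then show ?thesis using that left by blast
      next
        case False
        then show ?thesis using that[of y] y pc by blast
      qed
      then have "(i, if y < c then y else y - 1) \<in> points T" by (auto simp: mem)
      then show ?thesis by blast
    qed
    show "\<exists>i. (i, j) \<in> points T" if "(i, j) \<in> cells T" for i j
      using that D(7) by (auto simp: mem)
    fix i j assume ij: "(i, j) \<in> points T" "(i, j) \<noteq> (0, 0)"
    define j' where "j' = (if j < c then j else Suc j)"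
    have "(i, j') \<in> points T'" "(i, j') \<noteq> (0, 0)" using ij by (auto simp: mem j'_def)
    from D(5)[OF this] have "(\<exists>x<i. (x, j') \<in> points T') \<noteq> (\<exists>y<j'. (i, y) \<in> points T')" .
    moreover have "(\<exists>x<i. (x, j') \<in> points T') \<longleftrightarrow> (\<exists>x<i. (x, j) \<in> points T)"
      by (auto simp: mem j'_def)
    moreover have "(\<exists>y<j'. (i, y) \<in> points T') \<longleftrightarrow> (\<exists>y<j. (i, y) \<in> points T)"
    proof
      assume "\<exists>y<j. (i, y) \<in> points T"
      then obtain y where "y < j" "(i, y) \<in> points T" by blast
      then have "(i, if y < c then y else Suc y) \<in> points T'" "(if y < c then y else Suc y) < j'"
        by (auto simp: mem j'_def)
      then show "\<exists>y<j'. (i, y) \<in> points T'" by blast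
    next
      assume "\<exists>y<j'. (i, y) \<in> points T'"
      then obtain y where y: "y < j'" "(i, y) \<in> points T'" by blast
      \<comment> \<open>A point of row \<open>r\<close> to the right of column \<open>c\<close>
        would contradict the corner at \<open>(r, c)\<close>.\<close>
      have "y \<noteq> c"
      proof
        assume [simp]: "y = c"
        then have "i = r" using y pc by simp
        moreover have "Suc c \<le> j'" using y by simp
        ultimately show False using \<open>(i, j') \<in> points T'\<close> D(2) down[of r j' r "Suc c"] p by auto
      qed
      then have "(i, if y < c then y else y - 1) \<in> points T" "(if y < c then y else y - 1) < j"
        using y by (auto simp: mem j'_def split: if_splits)
      then show "\<exists>y<j. (i, y) \<in> points T" by blast
    qed
    ultimately show "(\<exists>i'<i. (i', j) \<in> points T) \<noteq> (\<exists>j'<j. (i, j') \<in> points T)" by blast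
  qed
qed

text \<open>Away from the root, condition (2) offers a point to the left or one above; the second
  case is the first one after transposition.\<close>

lemma insert_line_surj:
  assumes T': "tree_like_tableau T'" and p: "corner_point T' p" "p \<noteq> (0, 0)"
  obtains T e where "tree_like_tableau T" "valid_edge (cells T) e"
    "insert_line T e = T'" "new_point (cells T) e = p"
proof -
  obtain i j where [simp]: "p = (i, j)" by force
  have "(i, j) \<in> points T'" using p by (simp add: corner_point_def)
  from tltD(5)[OF T' this] p consider "\<exists>j'<j. (i, j') \<in> points T'" | "\<exists>i'<i. (i', j) \<in> points T'"
    by auto
  then show thesis
  proof cases
    case 1
    from insert_line_row_end_inverse[OF p(1)[simplified] T' this]
      that[of "Tableau (delete_column j (cells T')) (delete_column j (points T'))" "RowEnd i"]
    show thesis by simp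
  next
    case 2
    then have *: "\<exists>i'<i. (j, i') \<in> points (flip T')" by (simp add: mem_swap)
    have "corner_point (flip T') (j, i)" using p(1) corner_point_flip[of T' p] by simp
    from insert_line_row_end_inverse[OF this tlt_flip[OF T'] *]
    obtain T where T: "tree_like_tableau T" "valid_edge (cells T) (RowEnd j)"
       "insert_line T (RowEnd j) = flip T'" "new_point (cells T) (RowEnd j) = (j, i)"
      by auto
    show thesis
    proof (rule that)
      show "tree_like_tableau (flip T)" using T(1) by (rule tlt_flip)
      show "valid_edge (cells (flip T)) (ColBottom j)" using T(2) by (simp add: mem_swap)
      show "insert_line (flip T) (ColBottom j) = T'"
        using insert_line_flip[of T "RowEnd j"] T(3) by simp
      show "new_point (cells (flip T)) (ColBottom j) = p"
        using T(4) by (simp add: col_height_swap)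
    qed
  qed
qed

text \<open>The source of injectivity: \<open>c\<close> is the column of the new point, so the
  enlarged tableau and its new point determine \<open>T\<close>.\<close>

lemma insert_line_row_end_cells:
  assumes "row_len (cells T) r = c"
  shows "T = Tableau (delete_column c (cells (insert_line T (RowEnd r))))
               (delete_column c (points (insert_line T (RowEnd r))))"
  by (cases T) (use assms in \<open>auto simp: delete_column_def insert_line_row_end\<close>)

lemma insert_line_row_end_left:
  assumes T: "tree_like_tableau T" and r: "(r, 0) \<in> cells T" and p: "(r, c) = new_point (cells T) (RowEnd r)"
  shows "\<exists>j<c. (r, j) \<in> points (insert_line T (RowEnd r))"
proof -
  obtain y where y: "(r, y) \<in> points T" using tltD(6)[OF T r] by blast
  then have "y < c" using p ferrersD(2)[OF tltD(1)[OF T], of r y] tltD(2)[OF T] by auto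
  then show ?thesis using y p by (auto simp: insert_line_row_end)
qed

lemma new_point_in_insert_line: "new_point (cells T) e \<in> points (insert_line T e)"
  by (simp add: insert_line_def)

text \<open>An inserted column gets its new point in a row that already has points, all of them to
  the left. For an inserted row the transposed argument gives a point above, and condition (2) then
  excludes one to the left.\<close>

lemma insert_line_left_iff:
  assumes T: "tree_like_tableau T" and e: "valid_edge (cells T) e" and p: "new_point (cells T) e = (i, j)"
  shows "(\<exists>r. e = RowEnd r) \<longleftrightarrow> (\<exists>j'<j. (i, j') \<in> points (insert_line T e))"
proof (cases e)
  case (RowEnd r)
  then show ?thesis using insert_line_row_end_left[OF T, of r j] p e by auto
next
  case (ColBottom c)
  have c: "(c, 0) \<in> cells (flip T)" using e ColBottom by (simp add: mem_swap)
  have "\<exists>i'<i. (c, i') \<in> points (insert_line (flip T) (RowEnd c))"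
    by (rule insert_line_row_end_left[OF tlt_flip[OF T] c]) (use p ColBottom in \<open>auto simp: row_len_swap\<close>)
  moreover have "insert_line (flip T) (RowEnd c) = flip (insert_line T e)"
    using insert_line_flip[of T e] ColBottom by simp
  ultimately have *: "\<exists>i'<i. (i', j) \<in> points (insert_line T e)"
    using p ColBottom by (auto simp: mem_swap)
  then have "(i, j) \<noteq> (0, 0)" by auto
  then have "(\<exists>i'<i. (i', j) \<in> points (insert_line T e)) \<noteq> (\<exists>j'<j. (i, j') \<in> points (insert_line T e))"
    using tltD(5) insert_line_tlt[OF T e] new_point_in_insert_line[of T e] p by metis
  with * show ?thesis using ColBottom by auto
qed

lemma insert_line_inj:
  assumes T1: "tree_like_tableau T1" "valid_edge (cells T1) e1"
    and T2: "tree_like_tableau T2" "valid_edge (cells T2) e2"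
    and eq: "insert_line T1 e1 = insert_line T2 e2" "new_point (cells T1) e1 = new_point (cells T2) e2"
  shows "T1 = T2 \<and> e1 = e2"
proof -
  obtain i j where ij: "new_point (cells T1) e1 = (i, j)" by force
  have iff: "(\<exists>r. e1 = RowEnd r) \<longleftrightarrow> (\<exists>r. e2 = RowEnd r)"
    using insert_line_left_iff[OF T1 ij] insert_line_left_iff[OF T2, of i j] eq ij by simp
  have row: "T1 = T2 \<and> r1 = r2" if "insert_line T1 (RowEnd r1) = insert_line T2 (RowEnd r2)"
     "new_point (cells T1) (RowEnd r1) = new_point (cells T2) (RowEnd r2)" for T1 T2 r1 r2
    using that insert_line_row_end_cells[OF refl, of T1 r1] insert_line_row_end_cells[OF refl, of T2 r2]
    by (metis Pair_inject new_point.simps(1))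
  show ?thesis
  proof (cases e1)
    case (RowEnd r1)
    then show ?thesis using iff row eq by blast
  next
    case (ColBottom c1)
    then obtain c2 where e2: "e2 = ColBottom c2" using iff by (cases e2) auto
    have "flip T1 = flip T2 \<and> c1 = c2"
      using row[of "flip T1" c1 "flip T2" c2] insert_line_flip[of T1 e1] insert_line_flip[of T2 e2]
         eq ColBottom e2
      by (auto simp: row_len_swap)
    then show ?thesis using ColBottom e2 by (metis flip_flip)
  qed
qed

lemma shift_cell_inj: "inj (shift_cell D e)"
  by (cases e) (auto simp: inj_on_def split: if_splits)

lemma new_point_notin_shift: "new_point D e \<notin> shift_cell D e ` S"
  by (cases e) (auto split: if_splits)

lemma card_points_insert_line:
  assumes "finite (points T)"
  shows "card (points (insert_line T e)) = Suc (card (points T))"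
  using assms new_point_notin_shift card_image[OF inj_on_subset[OF shift_cell_inj subset_UNIV]]
  by (simp add: insert_line_def)

section \<open>The special point and the ribbon\<close>

text \<open>Being the lowest point of its column is not enough: no empty cell may lie below it
  either.\<close>

definition lowest_point :: "tableau \<Rightarrow> cell \<Rightarrow> bool" where
  "lowest_point T p \<longleftrightarrow> p \<in> points T \<and> (Suc (fst p), snd p) \<notin> cells T"

text \<open>The row of a lowest point is fixed by the height of its column, so two lowest points in
  one column coincide. Uniqueness of the special point and the strict inequality
  \<open>j < l\<close> in \<open>rim_position\<close> rest on this.\<close>

lemma lowest_point_row:
  assumes T: "tree_like_tableau T" and p: "lowest_point T (i, j)"
  shows "(x, j) \<in> cells T \<longleftrightarrow> x \<le> i"
  using p ferrers_down[OF tltD(1)[OF T], of i j x j] ferrers_down[OF tltD(1)[OF T], of x j "Suc i" j]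
    tltD(2)[OF T] unfolding lowest_point_def by force

text \<open>\<open>ARG_MAX\<close> chooses some point with maximal column, so it has to be shown
  that there is only one.\<close>

lemma special_point_eqI:
  assumes T: "tree_like_tableau T" and p: "lowest_point T p"
    and max: "\<And>q. lowest_point T q \<Longrightarrow> snd q \<le> snd p"
  shows "special_point T = p"
proof -
  have "special_point T = (SOME q. lowest_point T q \<and> (\<forall>q'. lowest_point T q' \<longrightarrow> snd q' \<le> snd q))"
    unfolding special_point_def arg_max_def is_arg_max_linorder lowest_point_def by simp
  also have "\<dots> = p"
  proof (rule some_equality)
    show "lowest_point T p \<and> (\<forall>q'. lowest_point T q' \<longrightarrow> snd q' \<le> snd p)"
      using p max by blast
    fix q assume q: "lowest_point T q \<and> (\<forall>q'. lowest_point T q' \<longrightarrow> snd q' \<le> snd q)"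
    then have "snd q = snd p" using p max[of q] by (meson order_antisym)
    moreover have "fst q = fst p"
    proof -
      have "x \<le> fst p \<longleftrightarrow> x \<le> fst q" for x
        using lowest_point_row[OF T, of "fst p" "snd p" x] lowest_point_row[OF T, of "fst q" "snd q" x]
          p q \<open>snd q = snd p\<close> by (metis prod.collapse)
      then show ?thesis by (metis order_antisym order_refl)
    qed
    ultimately show "q = p" by (simp add: prod_eq_iff)
  qed
  finally show ?thesis .
qed

text \<open>The bottom row contains a point, and no cell lies below it.\<close>

lemma lowest_point_exists:
  assumes T: "tree_like_tableau T"
  shows "\<exists>p. lowest_point T p"
proof -
  note D = tltD[OF T]
  have "(0, 0) \<in> cells T" using D(2,3) by blast
  then have "fst ` cells T \<noteq> {}" "finite (fst ` cells T)" using ferrersD(1)[OF D(1)] by auto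
  then have m: "Max (fst ` cells T) \<in> fst ` cells T" "\<And>c. c \<in> cells T \<Longrightarrow> fst c \<le> Max (fst ` cells T)"
    by auto
  then obtain y where "(Max (fst ` cells T), y) \<in> cells T" by force
  then obtain y where "(Max (fst ` cells T), y) \<in> points T" using D(6) by blast
  moreover have "(Suc (Max (fst ` cells T)), y) \<notin> cells T" using m(2) by fastforce
  ultimately show ?thesis unfolding lowest_point_def by (intro exI[of _ "(Max (fst ` cells T), y)"]) simp
qed

lemma special_point:
  assumes T: "tree_like_tableau T"
  shows "lowest_point T (special_point T)"
    and "lowest_point T q \<Longrightarrow> snd q \<le> snd (special_point T)"
proof -
  have "finite {q. lowest_point T q}"
    using tltD(4)[OF T] by (rule rev_finite_subset) (auto simp: lowest_point_def)
  then have fin: "finite (snd ` {q. lowest_point T q})" by blast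
  have "Max (snd ` {q. lowest_point T q}) \<in> snd ` {q. lowest_point T q}"
    using fin lowest_point_exists[OF T] by (intro Max_in) auto
  then obtain p where p: "lowest_point T p" "snd p = Max (snd ` {q. lowest_point T q})" by auto
  have max: "snd q \<le> snd p" if "lowest_point T q" for q
    unfolding p(2) using fin that by simp
  have "special_point T = p" by (rule special_point_eqI[OF T p(1) max])
  with p(1) max show "lowest_point T (special_point T)"
    "lowest_point T q \<Longrightarrow> snd q \<le> snd (special_point T)" by simp_all
qed

text \<open>The explicit form of the ribbon from the cell right of \<open>p\<close> to the cell below \<open>s\<close>: the cells outside
  \<open>D\<close> that touch \<open>D\<close> diagonally.  The truncated subtraction is harmless: for \<open>p\<close> in \<open>D\<close> no such cell
  lies in row or column 0.\<close>

definition rim :: "cell set \<Rightarrow> cell \<Rightarrow> cell \<Rightarrow> cell set" where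
  "rim D p s = {(x, y). (x, y) \<notin> D \<and> (x - 1, y - 1) \<in> D \<and> fst s < x \<and> x \<le> fst p \<and> y \<le> snd s}"

section \<open>Existence and uniqueness of the ribbon\<close>

lemma mem_rim:
  "(x, y) \<in> rim D (i, j) (k, l) \<longleftrightarrow>
     (x, y) \<notin> D \<and> (x - 1, y - 1) \<in> D \<and> k < x \<and> x \<le> i \<and> y \<le> l"
  by (simp add: rim_def)

text \<open>The ribbon is a matter of the diagram alone: \<open>(i, j)\<close> is the corner to
  whose right it starts, and \<open>(k, l)\<close> the column bottom under which it ends.\<close>

locale rim_position =
  fixes D :: "cell set" and i j k l :: nat
  assumes ferrers: "ferrers D"
    and corner: "(i, j) \<in> D" "(Suc i, j) \<notin> D" "(i, Suc j) \<notin> D"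
    and target: "(k, l) \<in> D" "(Suc k, l) \<notin> D"
    and p_before_s: "j < l"
begin

lemmas down = ferrers_down[OF ferrers]

lemma k_less_i: "k < i"
proof (rule ccontr)
  assume "\<not> k < i"
  then have "(i, Suc j) \<in> D" using down[OF target(1), of i "Suc j"] p_before_s by simp
  with corner show False by simp
qed

abbreviation "R \<equiv> rim D (i, j) (k, l)"

lemma rim_col: "(x, y) \<in> R \<Longrightarrow> j < y"
  using down[OF corner(1), of x y] by (auto simp: mem_rim not_less[symmetric])

lemma ferrers_union_rim: "ferrers (D \<union> R)"
proof (rule ferrersI)
  have "R \<subseteq> {..i} \<times> {..l}" by (auto simp: rim_def)
  then show "finite (D \<union> R)" using ferrersD(1)[OF ferrers] by (meson finite_UnI finite_SigmaI finite_atMost finite_subset)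
  fix x y x' y' assume a: "(x, y) \<in> D \<union> R" "x' \<le> x" "y' \<le> y"
  show "(x', y') \<in> D \<union> R"
  proof (cases "(x', y') \<in> D")
    case False
    then have "(x, y) \<in> R" using a down by blast
    then have xy: "(x - 1, y - 1) \<in> D" "k < x" "x \<le> i" "y \<le> l" by (auto simp: mem_rim)
    have "(x' - 1, y' - 1) \<in> D" using down[OF xy(1)] a by (meson diff_le_mono)
    moreover have "k < x'" using False down[OF target(1), of x' y'] a xy by force
    ultimately show ?thesis using False a xy by (auto simp: mem_rim)
  qed simp
qed

lemma start_in_rim: "(i, Suc j) \<in> R"
  using corner k_less_i p_before_s down[OF corner(1), of "i - 1" j] by (auto simp: mem_rim)

lemma end_in_rim: "(Suc k, l) \<in> R"
  using target k_less_i down[OF target(1), of k "l - 1"] by (auto simp: mem_rim)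

abbreviation "step \<equiv> {(x, y). x \<in> R \<and> y \<in> R \<and> adjacent x y}"

text \<open>From a rim cell one walks Southwest: left if the left neighbour is outside
  \<open>D\<close>, otherwise down. Either move stays in the rim and lowers
  \<open>y + (i - x)\<close>, and only the start has no move.\<close>

lemma rim_connected_to_start: "c \<in> R \<Longrightarrow> (c, (i, Suc j)) \<in> step\<^sup>*"
proof (induction "snd c + (i - fst c)" arbitrary: c rule: less_induct)
  case less
  obtain x y where c [simp]: "c = (x, y)" by force
  have xy: "(x, y) \<notin> D" "(x - 1, y - 1) \<in> D" "k < x" "x \<le> i" "y \<le> l" "j < y"
    using less.prems rim_col by (auto simp: mem_rim)
  show ?case
  proof (cases "c = (i, Suc j)")
    case False
    have "\<exists>c'\<in>R. adjacent c c' \<and> snd c' + (i - fst c') < snd c + (i - fst c)"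
    proof (cases "(x, y - 1) \<in> D")
      case False
      then have "(x, y - 1) \<in> R" using xy down[OF xy(2), of "x - 1" "y - 1 - 1"] by (auto simp: mem_rim)
      then show ?thesis using xy by (intro bexI[of _ "(x, y - 1)"]) (auto simp: adjacent_def)
    next
      case True
      \<comment> \<open>In row \<open>i\<close> the only rim cell with its left neighbour in
        \<open>D\<close> is the start, because row \<open>i\<close> of \<open>D\<close> ends at
        column \<open>j\<close>.\<close>
      have "x \<noteq> i"
      proof
        assume "x = i"
        then have "y \<noteq> Suc j" using False by auto
        then have "(i, Suc j) \<in> D" using True xy down[of x "y - 1" i "Suc j"] \<open>x = i\<close> by simp
        then show False using corner by simp
      qed
      moreover have "(Suc x, y) \<notin> D" using xy down[of "Suc x" y x y] by auto
      ultimately have "(Suc x, y) \<in> R" using xy True by (auto simp: mem_rim)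
      then show ?thesis using xy \<open>x \<noteq> i\<close> by (intro bexI[of _ "(Suc x, y)"]) (auto simp: adjacent_def)
    qed
    then obtain c' where "c' \<in> R" "adjacent c c'" "snd c' + (i - fst c') < snd c + (i - fst c)" by blast
    then have "(c, c') \<in> step" "(c', (i, Suc j)) \<in> step\<^sup>*" using less by auto
    then show ?thesis by (rule converse_rtrancl_into_rtrancl)
  qed simp
qed

lemma rim_is_ribbon: "is_ribbon D (i, Suc j) (Suc k, l) R"
  unfolding is_ribbon_def
proof (intro conjI)
  show "R \<inter> D = {}" by (auto simp: rim_def)
  have sym: "sym (step\<^sup>*)" by (rule sym_rtrancl) (auto simp: sym_def adjacent_def)
  show "connected_cells R"
    unfolding connected_cells_def using rim_connected_to_start symD[OF sym] rtrancl_trans by meson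
  \<comment> \<open>The southeast cell of such a square needs the northwest one to be in
    \<open>D\<close>.\<close>
  show "\<nexists>x y. {(x, y), (x, Suc y), (Suc x, y), (Suc x, Suc y)} \<subseteq> R" by (auto simp: rim_def)
  show "R \<subseteq> {fst (Suc k, l)..fst (i, Suc j)} \<times> {snd (i, Suc j)..snd (Suc k, l)}"
    using rim_col by (force simp: mem_rim)
qed (fact ferrers_union_rim start_in_rim end_in_rim)+

text \<open>Each cell of \<open>R'\<close> has its northwest neighbour in \<open>D\<close>, since
  otherwise the Ferrers shape would force a 2x2 square into \<open>R'\<close>. Conversely,
  connectedness gives two vertically adjacent cells of \<open>R'\<close> across each boundary
  between consecutive rows from \<open>Suc k\<close> to \<open>i\<close>, and these reach far enough
  right to force every rim cell into \<open>D \<union> R'\<close>.\<close>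

lemma ribbon_unique:
  assumes "is_ribbon D (i, Suc j) (Suc k, l) R'"
  shows "R' = R"
proof -
  have R': "R' \<inter> D = {}" "ferrers (D \<union> R')" "connected_cells R'"
    "\<And>x y. \<not> {(x, y), (x, Suc y), (Suc x, y), (Suc x, Suc y)} \<subseteq> R'"
    "(i, Suc j) \<in> R'" "(Suc k, l) \<in> R'"
    and win: "\<And>x y. (x, y) \<in> R' \<Longrightarrow> k < x \<and> x \<le> i \<and> j < y \<and> y \<le> l"
    using assms unfolding is_ribbon_def by (auto simp: Suc_le_eq)
  note down' = ferrers_down[OF R'(2)]
  let ?S = "{(x, y). x \<in> R' \<and> y \<in> R' \<and> adjacent x y}"
  \<comment> \<open>A path from the Southwest end to the Northeast end must at some point step from
    row \<open>Suc x\<close> to row \<open>x\<close>.\<close>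
  have cross: "\<exists>y. (Suc x, y) \<in> R' \<and> (x, y) \<in> R'" if x: "k < x" "x < i" for x
  proof -
    have "((i, Suc j), (Suc k, l)) \<in> ?S\<^sup>*"
      using R'(3,5,6) unfolding connected_cells_def by blast
    then have "x < fst (i, Suc j) \<longrightarrow> (\<exists>u v. (u, v) \<in> ?S \<and> x < fst u \<and> fst v \<le> x)"
    proof (induction rule: converse_rtrancl_induct)
      case base
      then show ?case using x by simp
    next
      case (step u v)
      then show ?case by (meson not_less)
    qed
    then obtain u v where "u \<in> R'" "v \<in> R'" "adjacent u v" "x < fst u" "fst v \<le> x" using x by auto
    then have "fst u = Suc x" "fst v = x" "snd u = snd v" by (auto simp: adjacent_def)
    then show ?thesis using \<open>u \<in> R'\<close> \<open>v \<in> R'\<close> by (metis prod.collapse)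
  qed
  have "(x, y) \<in> R' \<longleftrightarrow> (x, y) \<in> R" for x y
  proof
    assume r: "(x, y) \<in> R'"
    note w = win[OF r]
    have nD: "(x, y) \<notin> D" using r R'(1) by auto
    have "(x - 1, y - 1) \<in> D"
    proof (rule ccontr)
      assume n: "(x - 1, y - 1) \<notin> D"
      have "(x - 1, y - 1) \<in> R'" "(x - 1, y) \<in> R'" "(x, y - 1) \<in> R'"
        using n down down'[of x y] r by (meson UnE UnI2 diff_le_self order_refl)+
      then show False using R'(4)[of "x - 1" "y - 1"] r w by simp
    qed
    then show "(x, y) \<in> R" using nD w by (simp add: mem_rim)
  next
    assume r: "(x, y) \<in> R"
    then have xy: "(x, y) \<notin> D" "(x - 1, y - 1) \<in> D" "k < x" "x \<le> i" "y \<le> l" by (auto simp: mem_rim)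
    have "(x, y) \<in> D \<union> R'"
    proof (cases "x = Suc k")
      case True
      then show ?thesis using down'[of "Suc k" l x y] R'(6) xy by blast
    next
      case False
      then have "k < x - 1" "x - 1 < i" "Suc (x - 1) = x" using xy by linarith+
      then obtain y' where y': "(x, y') \<in> R'" "(x - 1, y') \<in> R'"
        using cross[of "x - 1"] by auto
      \<comment> \<open>\<open>(x - 1, y')\<close> is outside \<open>D\<close>, while
        \<open>(x - 1, y - 1)\<close> is inside.\<close>
      have "\<not> y' \<le> y - 1" using down[OF xy(2) order_refl] y'(2) R'(1) by blast
      then have "y \<le> y'" by linarith
      then show ?thesis using down'[of x y' x y] y' by blast
    qed
    then show "(x, y) \<in> R'" using xy by blast
  qed
  then show ?thesis by auto
qed

lemma ribbon_eq_rim: "ribbon D (i, Suc j) (Suc k, l) = R"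
  unfolding ribbon_def using rim_is_ribbon ribbon_unique by (rule the_equality)

end

section \<open>Adding the ribbon makes the new point special\<close>

definition add_ribbon :: "tableau \<Rightarrow> cell \<Rightarrow> tableau" where
  "add_ribbon T p =
     (if special_point T = p then T
      else Tableau (cells T \<union> rim (cells T) p (special_point T)) (points T))"

lemma rim_position:
  assumes T: "tree_like_tableau T" and p: "corner_point T (i, j)"
    and s: "special_point T = (k, l)" "(k, l) \<noteq> (i, j)"
  shows "rim_position (cells T) i j k l"
proof
  note D = tltD[OF T]
  have sp: "lowest_point T (k, l)" using special_point(1)[OF T] s by simp
  have pl: "lowest_point T (i, j)" using p by (simp add: corner_point_def lowest_point_def)
  show "ferrers (cells T)" "(i, j) \<in> cells T" "(Suc i, j) \<notin> cells T" "(i, Suc j) \<notin> cells T"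
    "(k, l) \<in> cells T" "(Suc k, l) \<notin> cells T"
    using D(1,2) p sp by (auto simp: corner_point_def lowest_point_def)
  have "j \<le> l" using special_point(2)[OF T pl] s by simp
  moreover have "j \<noteq> l"
  proof
    assume "j = l"
    then have "x \<le> i \<longleftrightarrow> x \<le> k" for x
      using lowest_point_row[OF T pl] lowest_point_row[OF T sp] by simp
    then have "i = k" by (metis order_antisym order_refl)
    then show False using s \<open>j = l\<close> by simp
  qed
  ultimately show "j < l" by simp
qed

text \<open>A column insertion keeps the old lowest points lowest. After a row insertion at the
  bottom of column \<open>c\<close>, those right of \<open>c\<close> are untouched, and those
  further left cannot compete with the new point, which lies in column \<open>c\<close>. So the new
  point and the old special point are the only candidates, and their order by columns agrees with
  \<open>edge_pos\<close> because the border rises towards the Northeast.\<close>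

lemma special_insert_line:
  assumes T: "tree_like_tableau T" and e: "valid_edge (cells T) e"
  defines "s \<equiv> special_point T" and "T' \<equiv> insert_line T e"
  shows "special_point T' =
    (if edge_pos (cells T) (ColBottom (snd s)) < edge_pos (cells T) e \<or> e = ColBottom (snd s)
     then new_point (cells T) e else shift_cell (cells T) e s)"
proof -
  note D = tltD[OF T]
  note down = ferrers_down[OF D(1)]
  have T': "tree_like_tableau T'" and corner: "corner_point T' (new_point (cells T) e)"
    using insert_line_tlt[OF T e] by (auto simp: T'_def)
  obtain k l where s: "s = (k, l)" by force
  have sp: "lowest_point T (k, l)" "\<And>q. lowest_point T q \<Longrightarrow> snd q \<le> l"
    using special_point[OF T] s by (auto simp: s_def)
  have hl: "col_height (cells T) l = Suc k"
    by (rule col_height_eqI) (simp add: lowest_point_row[OF T sp(1)] less_Suc_eq_le)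
  have low_new: "lowest_point T' (new_point (cells T) e)"
    using corner by (simp add: corner_point_def lowest_point_def)
  have pts: "points T' = insert (new_point (cells T) e) (shift_cell (cells T) e ` points T)"
    by (simp add: T'_def insert_line_def)
  show ?thesis
  proof (cases e)
    case (RowEnd r)
    define c where "c = row_len (cells T) r"
    have rc: "(r, y) \<in> cells T \<longleftrightarrow> y < c" for y
      using ferrersD(2)[OF D(1)] by (simp add: c_def)
    note mem = insert_line_row_end[of _ _ T r, folded c_def RowEnd, folded T'_def]
    have low: "lowest_point T' (x, y) \<longleftrightarrow>
       (if y = c then x = r else lowest_point T (x, if y < c then y else y - 1))" for x y
      by (auto simp: lowest_point_def mem)
    show ?thesis
    \<comment> \<open>The cell \<open>(r, l)\<close> exists exactly if \<open>l < c\<close>. So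
      \<open>l < c\<close> forces \<open>r \<le> k\<close> and \<open>c \<le> l\<close> forces
      \<open>k < r\<close>: rows and columns decide the order of the two edges in the same
      way.\<close>
    proof (cases "l < c")
      case True
      then have "r \<le> k" using rc[of l] lowest_point_row[OF T sp(1)] by simp
      moreover have "special_point T' = (r, c)"
        using low_new low sp(2) True by (intro special_point_eqI[OF T']) (fastforce split: if_splits simp: RowEnd c_def)+
      ultimately show ?thesis using True by (simp add: RowEnd s hl flip: c_def)
    next
      case False
      then have "k < r" using rc[of l] lowest_point_row[OF T sp(1)] by (simp add: not_le)
      moreover have "special_point T' = (k, Suc l)"
        using low sp False by (intro special_point_eqI[OF T']) (fastforce split: if_splits simp: RowEnd)+
      ultimately show ?thesis using False by (simp add: RowEnd s hl flip: c_def)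
    qed
  next
    case (ColBottom c)
    define h where "h = col_height (cells T) c"
    have ch: "(x, c) \<in> cells T \<longleftrightarrow> x < h" for x
      using ferrers_mem_col[OF D(1)] by (simp add: h_def)
    note mem = insert_line_col_bottom[of _ _ T c, folded h_def ColBottom, folded T'_def]
    have above: "x < h" if "(x, y) \<in> cells T" "c < y" for x y
      using down[OF that(1), of x c] that(2) ch by simp
    have cells_right: "(x, y) \<in> cells T' \<longleftrightarrow> (x, y) \<in> cells T" if "c < y" for x y
      using above[of x y] above[of "x - 1" y] that by (auto simp: mem)
    have "(x, y) \<in> points T' \<longleftrightarrow> (x, y) \<in> points T" if "c < y" for x y
      using above[of x y] above[of "x - 1" y] that D(2) by (auto simp: mem)
    with cells_right have low: "lowest_point T' (x, y) \<longleftrightarrow> lowest_point T (x, y)" if "c < y" for x y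
      using that by (simp add: lowest_point_def)
    show ?thesis
    proof (cases "l \<le> c")
      case True
      \<comment> \<open>Column \<open>l\<close> lies left of column \<open>c\<close>, so it is at
        least as tall, and its height is \<open>Suc k\<close>.\<close>
      have "h \<le> Suc k" if "l < c"
        using lowest_point_row[OF T sp(1), of "h - 1"] down[of "h - 1" c "h - 1" l] ch[of "h - 1"] that
        by (cases "h = 0") auto
      moreover have "special_point T' = new_point (cells T) e"
      proof (rule special_point_eqI[OF T' low_new])
        fix q assume "lowest_point T' q"
        then have "snd q \<le> c" using low[of "snd q" "fst q"] sp(2)[of q] True by fastforce
        then show "snd q \<le> snd (new_point (cells T) e)" by (simp add: ColBottom)
      qed
      ultimately show ?thesis using True by (auto simp: ColBottom s hl simp flip: h_def)
    next
      case False
      then have kh: "k < h" using above[of k l] sp(1) D(2) by (auto simp: lowest_point_def)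
      moreover have "special_point T' = (k, l)"
      proof (rule special_point_eqI[OF T'])
        show "lowest_point T' (k, l)" using low[of l k] sp(1) False by simp
        fix q assume "lowest_point T' q"
        then show "snd q \<le> snd (k, l)" using low[of "snd q" "fst q"] sp(2)[of q] False by fastforce
      qed
      ultimately show ?thesis using False by (simp add: ColBottom s hl flip: h_def)
    qed
  qed
qed

text \<open>\<open>add_ribbon\<close> looks only at the enlarged tableau and its marked point and no
  longer at \<open>T\<close> and \<open>e\<close>; in this form the second step can be inverted on
  its own. The special edge itself falls under the case without a ribbon.\<close>

lemma insertpoint_eq_add_ribbon:
  assumes T: "tree_like_tableau T" and e: "valid_edge (cells T) e"
  shows "insertpoint T e = add_ribbon (insert_line T e) (new_point (cells T) e)"
proof -
  define T' where "T' = insert_line T e"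
  obtain i j where p: "new_point (cells T) e = (i, j)" by force
  obtain k l where s: "shift_cell (cells T) e (special_point T) = (k, l)" by force
  have T': "tree_like_tableau T'" "corner_point T' (i, j)"
    using insert_line_tlt[OF T e] by (simp_all add: T'_def p)
  \<comment> \<open>The moved special point is an old point and so differs from the new one; hence
    the test in \<open>add_ribbon\<close> separates the two cases.\<close>
  have ne: "(k, l) \<noteq> (i, j)"
    using new_point_notin_shift[of "cells T" e UNIV] p s by (metis rangeI)
  note sp = special_insert_line[OF T e, folded T'_def, unfolded p s]
  show ?thesis
  proof (cases "edge_pos (cells T) (ColBottom (snd (special_point T))) < edge_pos (cells T) e \<or>
      e = ColBottom (snd (special_point T))")
    case True
    then show ?thesis
      using sp by (simp only: insertpoint_def add_ribbon_def Let_def p s prod.case simp_thms if_True flip: T'_def)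
  next
    case False
    then have *: "special_point T' = (k, l)" using sp by presburger
    have "ribbon (cells T') (i, Suc j) (Suc k, l) = rim (cells T') (i, j) (k, l)"
      using rim_position.ribbon_eq_rim[OF rim_position[OF T' * ne]] .
    then show ?thesis
      using False * ne
      by (simp only: insertpoint_def add_ribbon_def Let_def p s prod.case if_False flip: T'_def)
  qed
qed

lemma points_add_ribbon [simp]: "points (add_ribbon T p) = points T"
  by (simp add: add_ribbon_def)

text \<open>The ribbon stays at or above the row of \<open>p\<close> and at or left of the column of
  the old special point, so it creates no new row or column. A lowest point of \<open>T\<close>
  right of \<open>p\<close> gets a ribbon cell directly below it, which leaves \<open>p\<close> as
  the rightmost lowest point.\<close>

lemma add_ribbon_tlt:
  assumes T: "tree_like_tableau T" and p: "corner_point T p"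
  shows "tree_like_tableau (add_ribbon T p)" and "special_point (add_ribbon T p) = p"
proof -
  obtain i j where ij: "p = (i, j)" by force
  obtain k l where s: "special_point T = (k, l)" by force
  have "tree_like_tableau (add_ribbon T p) \<and> special_point (add_ribbon T p) = p"
  proof (cases "special_point T = p")
    case True
    then show ?thesis using T by (simp add: add_ribbon_def)
  next
    case False
    interpret rim_position "cells T" i j k l
      using rim_position[OF T] p s False ij by metis
    define U where "U = add_ribbon T p"
    have U: "cells U = cells T \<union> R" "points U = points T"
      using False by (auto simp: U_def add_ribbon_def ij s)
    note D = tltD[OF T]
    have U_tlt: "tree_like_tableau U"
    proof (rule tltI)
      show "ferrers (cells U)" using ferrers_union_rim by (simp add: U)
      show "points U \<subseteq> cells U" "(0, 0) \<in> points U" using D(2,3) by (auto simp: U)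
      show "(\<exists>i'<i. (i', j) \<in> points U) \<noteq> (\<exists>j'<j. (i, j') \<in> points U)"
        if "(i, j) \<in> points U" "(i, j) \<noteq> (0, 0)" for i j
        using D(5)[of i j] that unfolding U .
      fix x y assume xy: "(x, y) \<in> cells U"
      show "\<exists>y. (x, y) \<in> points U"
      proof (cases "(x, y) \<in> cells T")
        case True
        then show ?thesis using D(6) by (simp add: U)
      next
        case False
        then have "(x, j) \<in> cells T" using xy down[OF corner(1), of x j] by (simp add: U mem_rim)
        then show ?thesis using D(6) by (simp add: U)
      qed
      show "\<exists>x. (x, y) \<in> points U"
      proof (cases "(x, y) \<in> cells T")
        case True
        then show ?thesis using D(7) by (simp add: U)
      next
        case False
        then have "(k, y) \<in> cells T" using xy down[OF target(1), of k y] by (simp add: U mem_rim)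
        then show ?thesis using D(7) by (simp add: U)
      qed
    qed
    have "special_point U = p"
    proof (rule special_point_eqI[OF U_tlt])
      show "lowest_point U p"
        using p by (auto simp: lowest_point_def corner_point_def U ij mem_rim)
      fix q assume q: "lowest_point U q"
      obtain x y where xy: "q = (x, y)" by force
      have low: "(x, y) \<in> points T" "(Suc x, y) \<notin> cells T" "(Suc x, y) \<notin> R"
        using q by (auto simp: lowest_point_def U xy)
      have c: "(x, y) \<in> cells T" using low D(2) by blast
      have "lowest_point T (x, y)" using low by (simp add: lowest_point_def)
      then have "y \<le> l" using special_point(2)[OF T, of "(x, y)"] s by simp
      have "\<not> j < y"
      proof
        assume "j < y"
        then have "\<not> i \<le> x" using down[OF c, of i "Suc j"] p ij by (auto simp: corner_point_def)
        moreover have "\<not> Suc x \<le> k" using down[OF target(1), of "Suc x" y] low \<open>y \<le> l\<close> by auto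
        moreover have "(x, y - 1) \<in> cells T" using down[OF c] by simp
        ultimately have "(Suc x, y) \<in> R" using low \<open>y \<le> l\<close> by (simp add: mem_rim)
        with low show False by simp
      qed
      then show "snd q \<le> snd p" by (simp add: xy ij)
    qed
    with U_tlt show ?thesis by (simp add: U_def)
  qed
  then show "tree_like_tableau (add_ribbon T p)" "special_point (add_ribbon T p) = p" by auto
qed

text \<open>A ribbon ends below a point and at the end of its row; among the rows where this is possible,
  the removed ribbon ends at the lowest one that is above the special point.\<close>

definition ribbon_end_rows :: "tableau \<Rightarrow> nat \<Rightarrow> nat set" where
  "ribbon_end_rows U i =
     {x. x < i \<and> (\<exists>y. (x, y) \<in> points U \<and> (Suc x, y) \<in> cells U \<and> (Suc x, Suc y) \<notin> cells U)}"

text \<open>The ribbon seen from the other side: \<open>rim\<close> asks for a northwest neighbour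
  in the old diagram, this for a missing southeast neighbour in the enlarged one.\<close>

definition removable_rim :: "cell set \<Rightarrow> cell \<Rightarrow> nat \<Rightarrow> cell set" where
  "removable_rim D p k =
     {(x, y). (x, y) \<in> D \<and> (Suc x, Suc y) \<notin> D \<and> k < x \<and> x \<le> fst p \<and> snd p < y}"

lemma mem_removable_rim:
  "(x, y) \<in> removable_rim D (i, j) k \<longleftrightarrow> (x, y) \<in> D \<and> (Suc x, Suc y) \<notin> D \<and> k < x \<and> x \<le> i \<and> j < y"
  by (simp add: removable_rim_def)

text \<open>A ribbon starts in the cell right of \<open>p\<close>, and without a ribbon
  \<open>p\<close> is a corner, so that one cell tells whether there is anything to remove.\<close>

definition remove_ribbon :: "tableau \<Rightarrow> cell \<Rightarrow> tableau" where
  "remove_ribbon U p =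
     (if (fst p, Suc (snd p)) \<notin> cells U then U
      else Tableau (cells U - removable_rim (cells U) p (Max (ribbon_end_rows U (fst p)))) (points U))"

lemma Max_ribbon_end_rows:
  assumes "x \<in> ribbon_end_rows U i" "\<And>x'. x' \<in> ribbon_end_rows U i \<Longrightarrow> x' \<le> x"
  shows "Max (ribbon_end_rows U i) = x"
proof (rule Max_eqI)
  show "finite (ribbon_end_rows U i)"
    by (rule finite_subset[of _ "{..<i}"]) (auto simp: ribbon_end_rows_def)
qed (use assms in auto)

text \<open>The row \<open>k\<close> of the old special point qualifies as an end row. A lower row
  above \<open>p\<close> does not: its old cells lie left of column \<open>l\<close>, so their
  southeast neighbours fall in the old diagram or in the ribbon.\<close>

lemma remove_add_ribbon:
  assumes T: "tree_like_tableau T" and p: "corner_point T p"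
  shows "remove_ribbon (add_ribbon T p) p = T"
proof -
  obtain i j where ij: "p = (i, j)" by force
  obtain k l where s: "special_point T = (k, l)" by force
  show ?thesis
  proof (cases "special_point T = p")
    case True
    then show ?thesis using p by (simp add: add_ribbon_def remove_ribbon_def corner_point_def)
  next
    case False
    interpret rim_position "cells T" i j k l
      using rim_position[OF T] p s False ij by metis
    define U where "U = add_ribbon T p"
    have U: "cells U = cells T \<union> R" "points U = points T"
      using False by (auto simp: U_def add_ribbon_def ij s)
    have left_of_end: "y < l" if "(x, y) \<in> cells T" "k < x" for x y
      using down[OF that(1), of "Suc k" l] that(2) target(2) by force
    have inner: "(Suc x, Suc y) \<in> cells U" if "(x, y) \<in> cells T" "k < x" "x < i" for x y
      using that left_of_end[OF that(1,2)] by (auto simp: U mem_rim)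
    have "(k, l) \<in> points T" using special_point(1)[OF T] s by (simp add: lowest_point_def)
    moreover have "(Suc k, Suc l) \<notin> cells T" using down[of "Suc k" "Suc l" "Suc k" l] target(2) by auto
    ultimately have "k \<in> ribbon_end_rows U i"
      using end_in_rim k_less_i by (auto simp: ribbon_end_rows_def U mem_rim)
    moreover have "x \<le> k" if "x \<in> ribbon_end_rows U i" for x
      using that inner tltD(2)[OF T] by (force simp: ribbon_end_rows_def U(2))
    ultimately have k: "Max (ribbon_end_rows U i) = k" by (rule Max_ribbon_end_rows)
    have "removable_rim (cells U) p k = R"
    proof (rule set_eqI, clarify)
      fix x y
      show "(x, y) \<in> removable_rim (cells U) p k \<longleftrightarrow> (x, y) \<in> R"
      proof
        assume a: "(x, y) \<in> removable_rim (cells U) p k"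
        then have xy: "(x, y) \<in> cells U" "(Suc x, Suc y) \<notin> cells U" "k < x" "x \<le> i" "j < y"
          by (auto simp: ij mem_removable_rim)
        have "(x, y) \<notin> cells T"
        proof
          assume c: "(x, y) \<in> cells T"
          then have "x \<noteq> i" using down[OF c, of i "Suc j"] xy p ij by (auto simp: corner_point_def)
          then show False using inner[OF c] xy by simp
        qed
        then show "(x, y) \<in> R" using xy by (simp add: U)
      next
        assume a: "(x, y) \<in> R"
        then show "(x, y) \<in> removable_rim (cells U) p k"
          using rim_col[OF a] down[of "Suc x" "Suc y" x y] by (auto simp: ij mem_removable_rim U mem_rim)
      qed
    qed
    moreover have "cells T \<union> R - R = cells T" by (auto simp: mem_rim)
    ultimately have "remove_ribbon U p = Tableau (cells T) (points T)"
      using start_in_rim by (simp add: remove_ribbon_def k U ij)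
    then show ?thesis by (simp add: U_def)
  qed
qed

text \<open>As \<open>p\<close> is special, every point in a column right of it has a cell below.
  Taking the lowest end row then keeps points out of the removed cells, and the point above the end
  of the ribbon becomes special, so that \<open>add_ribbon\<close> restores exactly what was
  removed.\<close>

lemma remove_ribbon:
  assumes U: "tree_like_tableau U"
  defines "p \<equiv> special_point U" and "T \<equiv> remove_ribbon U (special_point U)"
  shows "tree_like_tableau T \<and> corner_point T p \<and> add_ribbon T p = U"
proof -
  obtain i j where ij: "p = (i, j)" by force
  note D = tltD[OF U]
  note down = ferrers_down[OF D(1)]
  have low: "lowest_point U (i, j)" "\<And>x y. lowest_point U (x, y) \<Longrightarrow> y \<le> j"
    using special_point[OF U] ij by (force simp: p_def)+
  have p: "(i, j) \<in> points U" "(i, j) \<in> cells U" "(Suc i, j) \<notin> cells U"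
    using low(1) D(2) by (auto simp: lowest_point_def)
  show ?thesis
  proof (cases "(i, Suc j) \<in> cells U")
    case False
    then have "T = U" by (simp add: T_def remove_ribbon_def ij flip: p_def)
    then show ?thesis
      using U False p by (simp add: corner_point_def add_ribbon_def ij) (simp add: p_def flip: ij)
  next
    case True
    have not_lowest: "(Suc x, y) \<in> cells U" if "(x, y) \<in> points U" "j < y" for x y
      using low(2)[of x y] that by (auto simp: lowest_point_def)
    have up: "x \<le> i" if "(x, y) \<in> cells U" "j \<le> y" for x y
      using down[OF that(1), of "Suc i" j] that p by force
    let ?K = "ribbon_end_rows U i"
    have "?K \<noteq> {}"
    proof -
      \<comment> \<open>The last column provides an end row: it lies right of \<open>p\<close>, it
        has a point, that point has a cell below it, and no column follows.\<close>
      define y where "y = row_len (cells U) 0 - 1"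
      have "(0, Suc j) \<in> cells U" using down[OF True] by simp
      then have y: "(0, y) \<in> cells U" "(0, Suc y) \<notin> cells U" "j < y"
        using ferrersD(2)[OF D(1), of 0] by (auto simp: y_def)
      then obtain x where x: "(x, y) \<in> points U" using D(7) by blast
      have "(Suc x, y) \<in> cells U" using not_lowest[OF x y(3)] .
      moreover from this have "x < i" using up[of "Suc x" y] y by simp
      moreover have "(Suc x, Suc y) \<notin> cells U" using down[of "Suc x" "Suc y" 0 "Suc y"] y by auto
      ultimately show ?thesis using x by (auto simp: ribbon_end_rows_def)
    qed
    moreover have finK: "finite ?K"
      by (rule finite_subset[of _ "{..<i}"]) (auto simp: ribbon_end_rows_def)
    ultimately obtain k where k: "k = Max ?K" "k \<in> ?K" "\<And>x. x \<in> ?K \<Longrightarrow> x \<le> k" by simp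
    then obtain l where l: "k < i" "(k, l) \<in> points U" "(Suc k, l) \<in> cells U" "(Suc k, Suc l) \<notin> cells U"
      by (auto simp: ribbon_end_rows_def)
    let ?R = "removable_rim (cells U) (i, j) k"
    have T: "cells T = cells U - ?R" "points T = points U"
      using True by (simp_all add: T_def remove_ribbon_def k(1) ij flip: p_def)
    have "j < l"
    proof (rule ccontr)
      assume "\<not> j < l"
      then have "(Suc k, Suc l) \<in> cells U" using down[OF True, of "Suc k" "Suc l"] l(1) by simp
      with l show False by simp
    qed
    have pts: "points T \<subseteq> cells T"
    proof (rule subsetI, clarify)
      fix x y assume xy: "(x, y) \<in> points T"
      \<comment> \<open>A point among the removed cells would give an end row below
        \<open>k\<close>, against maximality.\<close>
      have "(x, y) \<notin> ?R"
      proof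
        assume "(x, y) \<in> ?R"
        then have r: "(Suc x, Suc y) \<notin> cells U" "k < x" "x \<le> i" "j < y" by (auto simp: mem_removable_rim)
        then have c: "(Suc x, y) \<in> cells U" using not_lowest xy T by simp
        then have "x < i" using up[OF c] r by simp
        then have "x \<in> ?K" using c r xy T by (auto simp: ribbon_end_rows_def)
        then show False using k(3) r by force
      qed
      then show "(x, y) \<in> cells T" using xy D(2) by (auto simp: T)
    qed
    have T_tlt: "tree_like_tableau T"
    proof (rule tltI)
      show "ferrers (cells T)"
      proof (rule ferrersI)
        show "finite (cells T)" using ferrersD(1)[OF D(1)] by (simp add: T)
        fix x y x' y' assume a: "(x, y) \<in> cells T" "x' \<le> x" "y' \<le> y"
        then have c: "(x, y) \<in> cells U" "(x, y) \<notin> ?R" by (auto simp: T)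
        have "(x', y') \<notin> ?R"
        proof
          assume r: "(x', y') \<in> ?R"
          then have "j < y" "k < x" using a by (auto simp: mem_removable_rim)
          moreover have "(Suc x, Suc y) \<notin> cells U"
            using r a down[of "Suc x" "Suc y" "Suc x'" "Suc y'"] by (auto simp: mem_removable_rim)
          ultimately show False using c up[OF c(1)] by (simp add: mem_removable_rim)
        qed
        then show "(x', y') \<in> cells T" using down[OF c(1)] a by (simp add: T)
      qed
      show "points T \<subseteq> cells T" by (fact pts)
      show "(0, 0) \<in> points T" using D(3) by (simp add: T)
      show "(\<exists>i'<i. (i', j) \<in> points T) \<noteq> (\<exists>j'<j. (i, j') \<in> points T)"
        if "(i, j) \<in> points T" "(i, j) \<noteq> (0, 0)" for i j
        using D(5)[of i j] that unfolding T .
      show "\<exists>y. (x, y) \<in> points T" "\<exists>x. (x, y) \<in> points T" if "(x, y) \<in> cells T" for x y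
        using D(6,7)[of x y] that by (auto simp: T)
    qed
    have "(Suc i, Suc (Suc j)) \<notin> cells U" using down[of "Suc i" "Suc (Suc j)" "Suc i" j] p by auto
    then have corner: "corner_point T (i, j)"
      using True p l(1) by (simp add: corner_point_def T mem_removable_rim)
    have sp: "special_point T = (k, l)"
    proof (rule special_point_eqI[OF T_tlt])
      show "lowest_point T (k, l)"
        using l \<open>j < l\<close> down[of "Suc (Suc k)" "Suc l" "Suc k" "Suc l"]
        by (auto simp: lowest_point_def T mem_removable_rim)
      fix q assume q: "lowest_point T q"
      obtain x y where xy: "q = (x, y)" by force
      \<comment> \<open>A lowest point right of column \<open>l\<close> must have lost the cell
        below it to the ribbon. That cell is at or below row \<open>Suc k\<close> and right of
        column \<open>l\<close>, which puts \<open>(Suc k, Suc l)\<close> into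
        \<open>U\<close>.\<close>
      show "snd q \<le> snd (k, l)"
      proof (rule ccontr)
        assume "\<not> snd q \<le> snd (k, l)"
        then have "l < y" by (simp add: xy)
        then have "(Suc x, y) \<in> cells U" using not_lowest[of x y] q \<open>j < l\<close> by (simp add: xy lowest_point_def T)
        then have "(Suc x, y) \<in> ?R" using q by (simp add: xy lowest_point_def T)
        then have "(Suc x, y) \<in> cells U" "Suc k \<le> Suc x" by (auto simp: mem_removable_rim)
        then have "(Suc k, Suc l) \<in> cells U" using down[of "Suc x" y "Suc k" "Suc l"] \<open>l < y\<close> by simp
        with l show False by simp
      qed
    qed
    have "rim (cells T) (i, j) (k, l) = ?R"
    proof (rule set_eqI, clarify)
      fix x y
      show "(x, y) \<in> rim (cells T) (i, j) (k, l) \<longleftrightarrow> (x, y) \<in> ?R"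
      proof
        assume "(x, y) \<in> rim (cells T) (i, j) (k, l)"
        then have r: "(x, y) \<notin> cells T" "(x - 1, y - 1) \<in> cells T" "k < x" "x \<le> i" "y \<le> l"
          by (auto simp: mem_rim)
        have "(x, y) \<in> cells U"
        \<comment> \<open>In the top row of the window and up to its first column the northwest
          neighbour is outside the window, so the two end cells give membership; elsewhere a kept
          cell of the window must have its southeast neighbour in \<open>U\<close>.\<close>
        proof (cases "x = Suc k \<or> y \<le> Suc j")
          case True
          then show ?thesis using down[OF l(3), of x y] down[OF \<open>(i, Suc j) \<in> cells U\<close>, of x y] r by auto
        next
          case False
          then have "Suc (x - 1) = x" "Suc (y - 1) = y" "k < x - 1" "x - 1 \<le> i" "j < y - 1" using r by auto
          then show ?thesis using r(2) by (auto simp: T mem_removable_rim)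
        qed
        then show "(x, y) \<in> ?R" using r by (simp add: T)
      next
        assume a: "(x, y) \<in> ?R"
        then have r: "(x, y) \<in> cells U" "k < x" "x \<le> i" "j < y" by (auto simp: mem_removable_rim)
        have "\<not> Suc l \<le> y" using down[OF r(1), of "Suc k" "Suc l"] r(2) l(4) by auto
        moreover have "(x - 1, y - 1) \<in> cells U" using down[OF r(1)] by simp
        moreover have "(x - 1, y - 1) \<notin> ?R" using r by (auto simp: mem_removable_rim)
        ultimately show "(x, y) \<in> rim (cells T) (i, j) (k, l)" using r a by (simp add: mem_rim T)
      qed
    qed
    then have "add_ribbon T p = U"
      using l(1) unfolding add_ribbon_def sp ij
      by (auto simp: T mem_removable_rim intro!: tableau.expand)
    then show ?thesis using T_tlt corner ij by simp
  qed
qed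

section \<open>Insertion at a boundary edge as a bijection\<close>

lemma insertpoint_tlt:
  assumes T: "tree_like_tableau T" and e: "valid_edge (cells T) e"
  shows "tree_like_tableau (insertpoint T e)" "card (points (insertpoint T e)) = Suc (card (points T))"
    and "points (insertpoint T e) = points (insert_line T e)"
  using insert_line_tlt[OF T e] add_ribbon_tlt card_points_insert_line[OF tltD(4)[OF T]]
  by (simp_all add: insertpoint_eq_add_ribbon[OF T e])

lemma insertpoint_inj:
  assumes T1: "tree_like_tableau T1" "valid_edge (cells T1) e1"
    and T2: "tree_like_tableau T2" "valid_edge (cells T2) e2"
    and eq: "insertpoint T1 e1 = insertpoint T2 e2"
  shows "T1 = T2 \<and> e1 = e2"
proof -
  define p1 p2 where "p1 = new_point (cells T1) e1" and "p2 = new_point (cells T2) e2"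
  have I1: "tree_like_tableau (insert_line T1 e1)" "corner_point (insert_line T1 e1) p1"
    and I2: "tree_like_tableau (insert_line T2 e2)" "corner_point (insert_line T2 e2) p2"
    using insert_line_tlt T1 T2 by (simp_all add: p1_def p2_def)
  have eq': "add_ribbon (insert_line T1 e1) p1 = add_ribbon (insert_line T2 e2) p2"
    using eq by (simp add: insertpoint_eq_add_ribbon T1 T2 p1_def p2_def)
  then have p: "p1 = p2" using add_ribbon_tlt(2)[OF I1] add_ribbon_tlt(2)[OF I2] by simp
  moreover have "insert_line T1 e1 = insert_line T2 e2"
    using remove_add_ribbon[OF I1] remove_add_ribbon[OF I2] eq' p by metis
  ultimately show ?thesis using insert_line_inj[OF T1 T2] by (simp add: p1_def p2_def)
qed

lemma insertpoint_surj:
  assumes U: "tree_like_tableau U" "card (points U) \<ge> 2"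
  obtains T e where "tree_like_tableau T" "valid_edge (cells T) e" "insertpoint T e = U"
proof -
  define p where "p = special_point U"
  obtain T' where T': "tree_like_tableau T'" "corner_point T' p" "add_ribbon T' p = U"
    using remove_ribbon[OF U(1)] by (auto simp: p_def)
  \<comment> \<open>If the root were a corner of \<open>T'\<close>, the diagram would be that single
    cell, but there are at least two points.\<close>
  have "p \<noteq> (0, 0)"
  proof
    assume "p = (0, 0)"
    then have "(x, y) = (0, 0)" if "(x, y) \<in> cells T'" for x y
      using T'(2) ferrers_down[OF tltD(1)[OF T'(1)] that, of "Suc 0" 0]
        ferrers_down[OF tltD(1)[OF T'(1)] that, of 0 "Suc 0"]
      by (cases x; cases y) (auto simp: corner_point_def)
    then have "points T' \<subseteq> {(0, 0)}" using tltD(2)[OF T'(1)] by auto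
    then have "card (points T') \<le> 1" by (metis card.empty card_mono card_insert_disjoint finite.intros empty_iff One_nat_def)
    then show False using U(2) T'(3) by (metis points_add_ribbon not_less_eq_eq numeral_2_eq_2 One_nat_def)
  qed
  from insert_line_surj[OF T'(1,2) this] obtain T e where
    "tree_like_tableau T" "valid_edge (cells T) e" "insert_line T e = T'" "new_point (cells T) e = p" .
  then show thesis using that T'(3) by (simp add: insertpoint_eq_add_ribbon)
qed

section \<open>The tree of a tableau\<close>

lemma finite_points_below_right:
  assumes "finite (points T)"
  shows "finite (points_below T p)" "finite (points_right T p)"
proof -
  have "points_below T p \<subseteq> fst ` points T" "points_right T p \<subseteq> snd ` points T"
    by (force simp: points_below_def points_right_def)+
  then show "finite (points_below T p)" "finite (points_right T p)"
    using assms by (meson finite_imageI finite_subset)+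
qed

lemma Min_points_below:
  assumes "finite (points T)" "points_below T p \<noteq> {}"
  shows "fst p < Min (points_below T p)" "(Min (points_below T p), snd p) \<in> points T"
    and "fst p < i \<Longrightarrow> (i, snd p) \<in> points T \<Longrightarrow> Min (points_below T p) \<le> i"
  using Min_in[OF finite_points_below_right(1)[OF assms(1)] assms(2)]
    Min_le[OF finite_points_below_right(1)[OF assms(1)], of i p]
  by (simp_all add: points_below_def)

lemma Min_points_right:
  assumes "finite (points T)" "points_right T p \<noteq> {}"
  shows "snd p < Min (points_right T p)" "(fst p, Min (points_right T p)) \<in> points T"
    and "snd p < j \<Longrightarrow> (fst p, j) \<in> points T \<Longrightarrow> Min (points_right T p) \<le> j"
  using Min_in[OF finite_points_below_right(2)[OF assms(1)] assms(2)]
    Min_le[OF finite_points_below_right(2)[OF assms(1)], of j p]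
  by (simp_all add: points_right_def)

lemma subtree_at_unfold:
  assumes "finite (points T)"
  shows "subtree_at T p =
    Node (if points_below T p = {} then Leaf else subtree_at T (Min (points_below T p), snd p)) p
         (if points_right T p = {} then Leaf else subtree_at T (fst p, Min (points_right T p)))"
  using assms by (subst subtree_at.simps) simp

lemma subtree_at_neq_Leaf: "finite (points T) \<Longrightarrow> subtree_at T p \<noteq> Leaf"
  by (simp add: subtree_at_unfold)

lemma point_induct [consumes 1, case_names step]:
  assumes "finite (points T)"
    and "\<And>p. (points_below T p \<noteq> {} \<Longrightarrow> P (Min (points_below T p), snd p)) \<Longrightarrow>
              (points_right T p \<noteq> {} \<Longrightarrow> P (fst p, Min (points_right T p))) \<Longrightarrow> P p"
  shows "P p"
  using assms by (induction T p rule: subtree_at.induct) metis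

text \<open>Applied to a tableau before and after the ribbon is added: same points, different
  cells.\<close>

lemma subtree_at_cong:
  assumes "finite (points T)" "points T = points T'"
  shows "subtree_at T p = subtree_at T' p"
  using assms(1)
proof (induction p rule: point_induct)
  case (step p)
  have "points_below T' p = points_below T p" "points_right T' p = points_right T p"
    using assms(2) by (simp_all add: points_below_def points_right_def)
  then show ?case
    using step assms by (simp add: subtree_at_unfold[of T] subtree_at_unfold[of T'])
qed

section \<open>The points as nodes of a rooted tree\<close>

definition child :: "tableau \<Rightarrow> cell \<Rightarrow> cell \<Rightarrow> bool" where
  "child T p q \<longleftrightarrow>
     points_below T p \<noteq> {} \<and> q = (Min (points_below T p), snd p) \<or>
     points_right T p \<noteq> {} \<and> q = (fst p, Min (points_right T p))"

lemma childE:
  assumes fin: "finite (points T)" and "child T p q"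
  obtains (below) "q \<in> points T" "snd q = snd p" "fst p < fst q"
      "\<And>i. fst p < i \<Longrightarrow> (i, snd p) \<in> points T \<Longrightarrow> fst q \<le> i"
  | (right) "q \<in> points T" "fst q = fst p" "snd p < snd q"
      "\<And>j. snd p < j \<Longrightarrow> (fst p, j) \<in> points T \<Longrightarrow> snd q \<le> j"
proof -
  consider "points_below T p \<noteq> {}" "q = (Min (points_below T p), snd p)"
    | "points_right T p \<noteq> {}" "q = (fst p, Min (points_right T p))"
    using assms(2) unfolding child_def by blast
  then show thesis
  proof cases
    case 1
    then show thesis using Min_points_below[OF fin 1(1)] by (intro below) simp_all
  next
    case 2
    then show thesis using Min_points_right[OF fin 2(1)] by (intro right) simp_all
  qed
qed

lemma child_point:
  assumes "finite (points T)" "child T p q"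
  shows "q \<in> points T" "fst p + snd p < fst q + snd q"
  using assms by (auto elim!: childE)

lemma descendant_le:
  assumes "finite (points T)" "(child T)\<^sup>*\<^sup>* p q"
  shows "fst p + snd p \<le> fst q + snd q"
  using assms(2)
proof induction
  case (step y z)
  then show ?case using child_point(2)[OF assms(1) step(2)] by simp
qed simp

lemma descendant_point:
  assumes "finite (points T)" "(child T)\<^sup>*\<^sup>* p q" "p \<in> points T"
  shows "q \<in> points T"
  using assms(2,3) by induction (use child_point(1)[OF assms(1)] in auto)

text \<open>The parent is the nearest point on the side that condition (2) provides: the largest
  index before that of \<open>q\<close> in its column or row.\<close>

lemma child_exists:
  assumes T: "tree_like_tableau T" and q: "q \<in> points T" "q \<noteq> (0, 0)"
  shows "\<exists>p\<in>points T. child T p q"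
proof -
  obtain i j where ij: "q = (i, j)" by force
  have fin: "finite (points T)" by (rule tltD(4)[OF T])
  consider "\<exists>i'<i. (i', j) \<in> points T" | "\<exists>j'<j. (i, j') \<in> points T"
    using tltD(5)[OF T, of i j] q ij by auto
  then show ?thesis
  proof cases
    case 1
    define A where "A = {i'. i' < i \<and> (i', j) \<in> points T}"
    have A: "finite A" "A \<noteq> {}" using 1 by (auto simp: A_def)
    have m: "Max A < i" "(Max A, j) \<in> points T" using Max_in[OF A] by (auto simp: A_def)
    have "Min (points_below T (Max A, j)) = i"
    proof (rule Min_eqI)
      show "i \<in> points_below T (Max A, j)" using q ij m by (simp add: points_below_def)
      fix x assume x: "x \<in> points_below T (Max A, j)"
      then have "x \<notin> A" using Max_ge[OF A(1), of x] by (auto simp: points_below_def)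
      then show "i \<le> x" using x by (auto simp: A_def points_below_def)
    qed (rule finite_points_below_right[OF fin])
    moreover have "points_below T (Max A, j) \<noteq> {}" using q ij m by (auto simp: points_below_def)
    ultimately show ?thesis using m(2) by (intro bexI[of _ "(Max A, j)"]) (auto simp: child_def ij)
  next
    case 2
    define A where "A = {j'. j' < j \<and> (i, j') \<in> points T}"
    have A: "finite A" "A \<noteq> {}" using 2 by (auto simp: A_def)
    have m: "Max A < j" "(i, Max A) \<in> points T" using Max_in[OF A] by (auto simp: A_def)
    have "Min (points_right T (i, Max A)) = j"
    proof (rule Min_eqI)
      show "j \<in> points_right T (i, Max A)" using q ij m by (simp add: points_right_def)
      fix x assume x: "x \<in> points_right T (i, Max A)"
      then have "x \<notin> A" using Max_ge[OF A(1), of x] by (auto simp: points_right_def)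
      then show "j \<le> x" using x by (auto simp: A_def points_right_def)
    qed (rule finite_points_below_right[OF fin])
    moreover have "points_right T (i, Max A) \<noteq> {}" using q ij m by (auto simp: points_right_def)
    ultimately show ?thesis using m(2) by (intro bexI[of _ "(i, Max A)"]) (auto simp: child_def ij)
  qed
qed

text \<open>Here the "not both" of condition (2) enters: it fixes the direction of the parent, and
  in that direction the parent is the nearest point.\<close>

lemma child_unique:
  assumes T: "tree_like_tableau T"
    and p: "p \<in> points T" "child T p q" and p': "p' \<in> points T" "child T p' q"
  shows "p = p'"
proof -
  obtain i j where q: "q = (i, j)" by force
  obtain x y where xy: "p = (x, y)" by force
  obtain x' y' where xy': "p' = (x', y')" by force
  have fin: "finite (points T)" by (rule tltD(4)[OF T])
  have q': "(i, j) \<in> points T" "(i, j) \<noteq> (0, 0)"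
    using child_point[OF fin p(2)] by (auto simp: q)
  have dir: "y = j \<and> x < i \<and> (\<forall>z>x. (z, j) \<in> points T \<longrightarrow> i \<le> z) \<or>
      x = i \<and> y < j \<and> (\<forall>z>y. (i, z) \<in> points T \<longrightarrow> j \<le> z)"
    if "child T (x, y) q" for x y
    using childE[OF fin that] by (cases; auto simp: q)
  show ?thesis
    using dir[of x y] dir[of x' y'] tltD(5)[OF T q'] p p' unfolding xy xy'
    by (metis leD nat_neq_iff)
qed

text \<open>Climbing to the parent lowers the coordinate sum and stops only at the root.\<close>

lemma root_descendants:
  assumes T: "tree_like_tableau T" and "q \<in> points T"
  shows "(child T)\<^sup>*\<^sup>* (0, 0) q"
  using assms(2)
proof (induction "fst q + snd q" arbitrary: q rule: less_induct)
  case less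
  show ?case
  proof (cases "q = (0, 0)")
    case False
    then obtain p where "p \<in> points T" "child T p q" using child_exists[OF T less.prems] by blast
    then show ?thesis using less child_point(2)[OF tltD(4)[OF T]] by (meson rtranclp.rtrancl_into_rtrancl)
  qed simp
qed

lemma set_tree_subtree_at:
  assumes "finite (points T)"
  shows "set_tree (subtree_at T p) = {q. (child T)\<^sup>*\<^sup>* p q}"
  using assms
proof (induction p rule: point_induct)
  case (step p)
  have "{q. (child T)\<^sup>*\<^sup>* p q} = insert p (\<Union>r\<in>{r. child T p r}. {q. (child T)\<^sup>*\<^sup>* r q})"
    by (auto intro: converse_rtranclp_into_rtranclp elim: converse_rtranclpE)
  moreover have "{r. child T p r} =
      (if points_below T p = {} then {} else {(Min (points_below T p), snd p)}) \<union>
      (if points_right T p = {} then {} else {(fst p, Min (points_right T p))})"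
    by (auto simp: child_def)
  ultimately show ?case
    using step by (simp add: subtree_at_unfold[OF assms, of p])
qed

text \<open>Parents are unique, so the ancestors of \<open>x\<close> form a chain.\<close>

lemma descendants_comparable:
  assumes T: "tree_like_tableau T" and "(child T)\<^sup>*\<^sup>* a x" "(child T)\<^sup>*\<^sup>* b x" "a \<in> points T" "b \<in> points T"
  shows "(child T)\<^sup>*\<^sup>* a b \<or> (child T)\<^sup>*\<^sup>* b a"
  using assms(2,3)
proof (induction rule: rtranclp_induct)
  case (step y z)
  from step.prems show ?case
  proof (cases rule: rtranclp.cases)
    case rtrancl_refl
    then show ?thesis using step by (meson rtranclp.rtrancl_into_rtrancl)
  next
    case (rtrancl_into_rtrancl y')
    then have "y' = y"
      using child_unique[OF T] step descendant_point[OF tltD(4)[OF T]] assms(4,5) by metis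
    then show ?thesis using step rtrancl_into_rtrancl by blast
  qed
qed simp

text \<open>If the subtrees met, one sibling would descend from the other, and the common parent
  would descend from its own child; but coordinate sums grow along descent.\<close>

lemma siblings_disjoint:
  assumes T: "tree_like_tableau T" and p: "p \<in> points T" and ab: "child T p a" "child T p b" "a \<noteq> b"
  shows "\<not> ((child T)\<^sup>*\<^sup>* a x \<and> (child T)\<^sup>*\<^sup>* b x)"
proof -
  note fin = tltD(4)[OF T]
  have no: "\<not> (child T)\<^sup>*\<^sup>* a b" if "child T p a" "child T p b" "a \<noteq> b" for a b
  proof
    assume "(child T)\<^sup>*\<^sup>* a b"
    then obtain y where y: "(child T)\<^sup>*\<^sup>* a y" "child T y b" using \<open>a \<noteq> b\<close> by (metis rtranclp.cases)
    have "y \<in> points T" using descendant_point[OF fin y(1)] child_point(1)[OF fin that(1)] .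
    then have "y = p" using child_unique[OF T _ y(2) p that(2)] by simp
    then show False using descendant_le[OF fin y(1)] child_point(2)[OF fin that(1)] by simp
  qed
  show ?thesis
    using descendants_comparable[OF T, of a x b] no[OF ab] no[OF ab(2,1)] ab child_point(1)[OF fin] by blast
qed

lemma subtrees_disjoint:
  assumes T: "tree_like_tableau T" and p: "p \<in> points T"
    and ne: "points_below T p \<noteq> {}" "points_right T p \<noteq> {}"
  shows "set_tree (subtree_at T (Min (points_below T p), snd p)) \<inter>
         set_tree (subtree_at T (fst p, Min (points_right T p))) = {}"
proof -
  note fin = tltD(4)[OF T]
  have "(Min (points_below T p), snd p) \<noteq> (fst p, Min (points_right T p))"
    using Min_points_below(1)[OF fin ne(1)] by auto
  then show ?thesis
    using siblings_disjoint[OF T p, of "(Min (points_below T p), snd p)" "(fst p, Min (points_right T p))"] ne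
    by (auto simp: set_tree_subtree_at[OF fin] child_def)
qed

lemma root_notin_subtree:
  assumes "finite (points T)" "child T p q"
  shows "p \<notin> set_tree (subtree_at T q)"
  using descendant_le[OF assms(1), of q p] child_point(2)[OF assms]
  by (auto simp: set_tree_subtree_at[OF assms(1)])

lemma distinct_inorder_subtree_at:
  assumes T: "tree_like_tableau T"
  shows "p \<in> points T \<Longrightarrow> distinct (inorder (subtree_at T p))"
  using tltD(4)[OF T]
proof (induction p rule: point_induct)
  case (step p)
  note fin = tltD(4)[OF T]
  define a b where "a = (Min (points_below T p), snd p)" and "b = (fst p, Min (points_right T p))"
  have a: "child T p a" if "points_below T p \<noteq> {}" using that by (simp add: child_def a_def)
  have b: "child T p b" if "points_right T p \<noteq> {}" using that by (simp add: child_def b_def)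
  show ?case
    using step.IH subtrees_disjoint[OF T step.prems] a b root_notin_subtree[OF fin a] root_notin_subtree[OF fin b]
      child_point(1)[OF fin a] child_point(1)[OF fin b]
    by (simp add: subtree_at_unfold[OF fin, of p] flip: a_def b_def)
qed

lemma set_tree_point_tree:
  assumes T: "tree_like_tableau T"
  shows "set_tree (tableau_point_tree T) = points T"
  using root_descendants[OF T] descendant_point[OF tltD(4)[OF T] _ tltD(3)[OF T]]
  by (auto simp: tableau_point_tree_def set_tree_subtree_at[OF tltD(4)[OF T]])

lemma size_point_tree:
  assumes T: "tree_like_tableau T"
  shows "size (tableau_point_tree T) = card (points T)"
  using distinct_card[OF distinct_inorder_subtree_at[OF T tltD(3)[OF T]]] set_tree_point_tree[OF T]
  by (simp add: tableau_point_tree_def)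

section \<open>The leaves are exactly the boundary edges\<close>

lemma leaf_edges_subtree_at:
  assumes "finite (points T)"
  shows "ColBottom c \<in> set (leaf_edges (subtree_at T p)) \<longleftrightarrow>
           (\<exists>q\<in>set_tree (subtree_at T p). snd q = c \<and> points_below T q = {})"
    and "RowEnd r \<in> set (leaf_edges (subtree_at T p)) \<longleftrightarrow>
           (\<exists>q\<in>set_tree (subtree_at T p). fst q = r \<and> points_right T q = {})"
proof -
  show "ColBottom c \<in> set (leaf_edges (subtree_at T p)) \<longleftrightarrow>
           (\<exists>q\<in>set_tree (subtree_at T p). snd q = c \<and> points_below T q = {})"
    using assms
  proof (induction p rule: point_induct)
    case (step p)
    then show ?case
      by (auto simp: subtree_at_unfold[OF assms, of p] subtree_at_neq_Leaf[OF assms])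
  qed
  show "RowEnd r \<in> set (leaf_edges (subtree_at T p)) \<longleftrightarrow>
           (\<exists>q\<in>set_tree (subtree_at T p). fst q = r \<and> points_right T q = {})"
    using assms
  proof (induction p rule: point_induct)
    case (step p)
    then show ?case
      by (auto simp: subtree_at_unfold[OF assms, of p] subtree_at_neq_Leaf[OF assms])
  qed
qed

lemma same_column_bottom:
  assumes "p \<in> points T" "q \<in> points T" "snd p = snd q" "points_below T p = {}" "points_below T q = {}"
  shows "p = q"
  using assms by (cases p; cases q) (auto simp: points_below_def intro: order_antisym leI)

lemma same_row_end:
  assumes "p \<in> points T" "q \<in> points T" "fst p = fst q" "points_right T p = {}" "points_right T q = {}"
  shows "p = q"
  using assms by (cases p; cases q) (auto simp: points_right_def intro: order_antisym leI)

text \<open>An edge hangs from the last point of its column or row, which is unique, and the two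
  subtrees of a point share no points. This is what makes the index of a leaf recoverable from its
  edge.\<close>

lemma distinct_leaf_edges:
  assumes T: "tree_like_tableau T"
  shows "p \<in> points T \<Longrightarrow> distinct (leaf_edges (subtree_at T p))"
  using tltD(4)[OF T]
proof (induction p rule: point_induct)
  case (step p)
  note fin = tltD(4)[OF T]
  note le = leaf_edges_subtree_at[OF fin]
  define a b where "a = (Min (points_below T p), snd p)" and "b = (fst p, Min (points_right T p))"
  have a: "child T p a" if "points_below T p \<noteq> {}" using that by (simp add: child_def a_def)
  have b: "child T p b" if "points_right T p \<noteq> {}" using that by (simp add: child_def b_def)
  have sub: "set_tree (subtree_at T q) \<subseteq> points T" if "child T p q" for q
    using descendant_point[OF fin _ child_point(1)[OF fin that]] by (auto simp: set_tree_subtree_at[OF fin])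
  have clash: False if "set_tree (subtree_at T q) \<subseteq> points T" "set_tree (subtree_at T q') \<subseteq> points T"
    "e \<in> set (leaf_edges (subtree_at T q))" "e \<in> set (leaf_edges (subtree_at T q'))"
    "set_tree (subtree_at T q) \<inter> set_tree (subtree_at T q') = {}" for e q q'
    using that same_column_bottom same_row_end by (cases e) (auto simp: le, (metis disjoint_iff subsetD)+)
  have 1: "ColBottom (snd p) \<notin> set (leaf_edges (subtree_at T b))"
    if "points_below T p = {}" "points_right T p \<noteq> {}"
    using same_column_bottom[OF step.prems, of _ ] sub[OF b] root_notin_subtree[OF fin b] that
    by (metis le(1) subsetD)
  have 2: "RowEnd (fst p) \<notin> set (leaf_edges (subtree_at T a))"
    if "points_right T p = {}" "points_below T p \<noteq> {}"
    using same_row_end[OF step.prems] sub[OF a] root_notin_subtree[OF fin a] that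
    by (metis le(2) subsetD)
  have 3: "set (leaf_edges (subtree_at T a)) \<inter> set (leaf_edges (subtree_at T b)) = {}"
    if "points_below T p \<noteq> {}" "points_right T p \<noteq> {}"
    using clash[OF sub[OF a] sub[OF b]] that subtrees_disjoint[OF T step.prems that]
    unfolding a_def b_def by blast
  show ?case
    using step.IH child_point(1)[OF fin a] child_point(1)[OF fin b] 1 2 3
    by (simp add: subtree_at_unfold[OF fin, of p] subtree_at_neq_Leaf[OF fin] flip: a_def b_def)
qed

text \<open>Every existing row or column contains points, hence a last one, and the child missing
  there is the leaf.\<close>

lemma set_leaf_edges:
  assumes T: "tree_like_tableau T"
  shows "e \<in> set (leaf_edges (tableau_point_tree T)) \<longleftrightarrow> valid_edge (cells T) e"
proof -
  note D = tltD[OF T]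
  note down = ferrers_down[OF D(1)]
  note st = set_tree_point_tree[OF T, unfolded tableau_point_tree_def]
  show ?thesis
  proof (cases e)
    case (ColBottom c)
    have "(\<exists>q\<in>points T. snd q = c \<and> points_below T q = {}) \<longleftrightarrow> (0, c) \<in> cells T"
    proof
      assume "(0, c) \<in> cells T"
      then obtain x where x: "(x, c) \<in> points T" using D(7) by blast
      define A where "A = {x. (x, c) \<in> points T}"
      have "A \<subseteq> fst ` points T" by (force simp: A_def)
      then have A: "finite A" "A \<noteq> {}" using x D(4) by (auto simp: A_def dest: finite_subset)
      have "(Max A, c) \<in> points T" using Max_in[OF A] by (simp add: A_def)
      moreover have "points_below T (Max A, c) = {}"
        using Max_ge[OF A(1)] by (force simp: points_below_def A_def not_le)
      ultimately show "\<exists>q\<in>points T. snd q = c \<and> points_below T q = {}" by force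
    qed (use D(2) down in force)
    then show ?thesis by (simp add: ColBottom tableau_point_tree_def leaf_edges_subtree_at[OF D(4)] st)
  next
    case (RowEnd r)
    have "(\<exists>q\<in>points T. fst q = r \<and> points_right T q = {}) \<longleftrightarrow> (r, 0) \<in> cells T"
    proof
      assume "(r, 0) \<in> cells T"
      then obtain x where x: "(r, x) \<in> points T" using D(6) by blast
      define A where "A = {x. (r, x) \<in> points T}"
      have "A \<subseteq> snd ` points T" by (force simp: A_def)
      then have A: "finite A" "A \<noteq> {}" using x D(4) by (auto simp: A_def dest: finite_subset)
      have "(r, Max A) \<in> points T" using Max_in[OF A] by (simp add: A_def)
      moreover have "points_right T (r, Max A) = {}"
        using Max_ge[OF A(1)] by (force simp: points_right_def A_def not_le)
      ultimately show "\<exists>q\<in>points T. fst q = r \<and> points_right T q = {}" by force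
    qed (use D(2) down in force)
    then show ?thesis by (simp add: RowEnd tableau_point_tree_def leaf_edges_subtree_at[OF D(4)] st)
  qed
qed

section \<open>Replacing a leaf by a node\<close>

lemma length_leaf_edges: "t \<noteq> Leaf \<Longrightarrow> length (leaf_edges t) = Suc (size t)"
  by (induction t) auto

text \<open>Leaves are counted from 0, and a tree has one leaf more than nodes, so the left subtree
  holds the leaves \<open>0\<close> to \<open>size l\<close>.\<close>

fun replace_leaf :: "nat \<Rightarrow> 'a tree \<Rightarrow> 'a tree \<Rightarrow> 'a tree" where
  "replace_leaf k s Leaf = (if k = 0 then s else Leaf)"
| "replace_leaf k s (Node l x r) =
     (if k \<le> size l then Node (replace_leaf k s l) x r
      else Node l x (replace_leaf (k - Suc (size l)) s r))"

text \<open>Leaves of the tree of points are identified by boundary edges, as in \<open>leaf_edges\<close>.\<close>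

fun graft :: "edge \<Rightarrow> cell tree \<Rightarrow> unit tree" where
  "graft e Leaf = Leaf"
| "graft e (Node l p r) =
     Node (if l = Leaf then if e = ColBottom (snd p) then Node Leaf () Leaf else Leaf else graft e l) ()
          (if r = Leaf then if e = RowEnd (fst p) then Node Leaf () Leaf else Leaf else graft e r)"

lemma forget_labels_simps [simp]:
  "forget_labels Leaf = Leaf" "forget_labels (Node l x r) = Node (forget_labels l) () (forget_labels r)"
  "size (forget_labels t) = size t"
  by (simp_all add: forget_labels_def)

lemma forget_labels_mirror: "forget_labels (mirror t) = mirror (forget_labels t)"
  by (simp add: forget_labels_def map_mirror)

lemma forget_labels_map: "forget_labels (map_tree f t) = forget_labels t"
  by (simp add: forget_labels_def tree.map_comp comp_def)

lemma graft_no_leaf: "e \<notin> set (leaf_edges t) \<Longrightarrow> graft e t = forget_labels t"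
  by (induction t) (auto split: if_splits)

text \<open>\<open>graft\<close> changes every leaf that carries the edge; distinctness reduces this
  to the one at index \<open>k\<close>.\<close>

lemma graft_nth_leaf:
  assumes "distinct (leaf_edges t)" "k \<le> size t" "t \<noteq> Leaf"
  shows "graft (leaf_edges t ! k) t = replace_leaf k (Node Leaf () Leaf) (forget_labels t)"
  using assms
proof (induction t arbitrary: k)
  case (Node l p r)
  define A where "A = (if l = Leaf then [ColBottom (snd p)] else leaf_edges l)"
  define B where "B = (if r = Leaf then [RowEnd (fst p)] else leaf_edges r)"
  have len: "length A = Suc (size l)" "length B = Suc (size r)"
    by (simp_all add: A_def B_def length_leaf_edges)
  have AB: "leaf_edges (Node l p r) = A @ B" by (simp add: A_def B_def)
  have dist: "distinct A" "distinct B" "set A \<inter> set B = {}"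
    using Node.prems(1) unfolding AB by auto
  show ?case
  proof (cases "k \<le> size l")
    case True
    then have e: "leaf_edges (Node l p r) ! k = A ! k" "A ! k \<in> set A"
      using len unfolding AB by (auto simp: nth_append)
    then have e': "A ! k \<notin> set B" using dist(3) by blast
    have "(if l = Leaf then if A ! k = ColBottom (snd p) then Node Leaf () Leaf else Leaf else graft (A ! k) l)
        = replace_leaf k (Node Leaf () Leaf) (forget_labels l)"
      using True Node.IH(1)[of k] dist(1) by (auto simp: A_def)
    moreover have "(if r = Leaf then if A ! k = RowEnd (fst p) then Node Leaf () Leaf else Leaf else graft (A ! k) r)
        = forget_labels r"
      using e' graft_no_leaf[of "A ! k" r] by (auto simp: B_def)
    ultimately show ?thesis using True unfolding e(1) by simp
  next
    case False
    define k' where "k' = k - Suc (size l)"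
    have k': "k' \<le> size r" using Node.prems(2) False by (simp add: k'_def)
    have e: "leaf_edges (Node l p r) ! k = B ! k'" "B ! k' \<in> set B"
      using len False k' unfolding AB by (auto simp: nth_append k'_def)
    then have e': "B ! k' \<notin> set A" using dist(3) by blast
    have "(if r = Leaf then if B ! k' = RowEnd (fst p) then Node Leaf () Leaf else Leaf else graft (B ! k') r)
        = replace_leaf k' (Node Leaf () Leaf) (forget_labels r)"
      using k' Node.IH(2)[of k'] dist(2) by (auto simp: B_def)
    moreover have "(if l = Leaf then if B ! k' = ColBottom (snd p) then Node Leaf () Leaf else Leaf else graft (B ! k') l)
        = forget_labels l"
      using e' graft_no_leaf[of "B ! k'" l] by (auto simp: A_def)
    moreover have "replace_leaf k s (Node t x u) = Node t x (replace_leaf k' s u)"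
      if "size t = size l" for s t u and x :: unit
      using False that by (simp add: k'_def)
    ultimately show ?thesis unfolding e(1) by simp
  qed
qed simp

section \<open>The effect of an insertion on the tree\<close>

lemma points_below_flip: "points_below (flip T) (prod.swap p) = points_right T p"
  by (auto simp: points_below_def points_right_def mem_swap)

lemma points_right_flip: "points_right (flip T) (prod.swap p) = points_below T p"
  by (auto simp: points_below_def points_right_def mem_swap)

lemma subtree_at_flip:
  assumes fin: "finite (points T)"
  shows "subtree_at (flip T) (prod.swap p) = mirror (map_tree prod.swap (subtree_at T p))"
  using fin
proof (induction p rule: point_induct)
  case (step p)
  have "finite (points (flip T))" using fin by simp
  then show ?case using step
    by (simp add: subtree_at_unfold[OF fin, of p] subtree_at_unfold[of "flip T" "prod.swap p"]
        points_below_flip points_right_flip)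
qed

lemma graft_flip: "graft (flip_edge e) (mirror (map_tree prod.swap t)) = mirror (graft e t)"
  by (induction t; cases e) auto

text \<open>Skipping column \<open>c\<close> is a strictly monotone renumbering, so nearest points
  stay nearest. The new point comes after all points of row \<open>r\<close> and is alone in its
  column, so it becomes the right child of the last point of row \<open>r\<close>, in place of the
  leaf \<open>RowEnd r\<close>.\<close>

lemma subtree_at_insert_row_end:
  assumes T: "tree_like_tableau T" and r: "(r, 0) \<in> cells T"
  defines "T' \<equiv> insert_line T (RowEnd r)"
  shows "p \<in> points T \<Longrightarrow>
    forget_labels (subtree_at T' (shift_cell (cells T) (RowEnd r) p)) = graft (RowEnd r) (subtree_at T p)"
  using tltD(4)[OF T]
proof (induction p rule: point_induct)
  case (step p)
  note fin = tltD(4)[OF T]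
  have fin': "finite (points T')" using tltD(4) insert_line_row_end_tlt(1)[OF T r] by (simp add: T'_def)
  define c where "c = row_len (cells T) r"
  define g where "g j = (if j < c then j else Suc j)" for j
  have g: "mono g" "g j \<noteq> c" "inj g" for j by (auto simp: mono_def g_def inj_on_def split: if_splits)
  have glt: "g y < g j \<longleftrightarrow> y < j" for y j by (auto simp: g_def)
  note mem = insert_line_row_end(2)[of _ _ T r, folded c_def T'_def]
  have mem_g: "(x, g y) \<in> points T' \<longleftrightarrow> (x, y) \<in> points T" for x y by (auto simp: mem g_def)
  have rc: "y < c" if "(r, y) \<in> points T" for y
    using that tltD(2)[OF T] ferrersD(2)[OF tltD(1)[OF T], of r y] by (auto simp: c_def)
  have sh: "shift_cell (cells T) (RowEnd r) (x, y) = (x, g y)" for x y by (simp add: g_def c_def)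
  obtain x y where xy: "p = (x, y)" by force
  have p: "(x, y) \<in> points T" using step.prems xy by simp
  have below: "points_below T' (x, g y) = points_below T p"
    by (simp add: points_below_def xy mem_g)
  have right: "points_right T' (x, g y) = g ` points_right T p \<union> (if x = r then {c} else {})"
  proof (rule set_eqI)
    fix j
    show "j \<in> points_right T' (x, g y) \<longleftrightarrow> j \<in> g ` points_right T p \<union> (if x = r then {c} else {})"
    proof (cases "j = c")
      case True
      then show ?thesis using rc[of y] p g(2) by (auto simp: points_right_def mem g_def xy)
    next
      case False
      then have "j = g (if j < c then j else j - 1)" by (auto simp: g_def)
      then obtain j' where "j = g j'" by blast
      then show ?thesis
        using g(2) by (simp add: points_right_def mem_g glt xy inj_image_mem_iff[OF g(3)])
    qed
  qed
  have new: "subtree_at T' (r, c) = Node Leaf (r, c) Leaf"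
  proof -
    have "points_below T' (r, c) = {}" by (auto simp: points_below_def mem)
    moreover have "points_right T' (r, c) = {}" using rc by (force simp: points_right_def mem)
    ultimately show ?thesis by (simp add: subtree_at_unfold[OF fin'])
  qed
  have finr: "finite (points_right T p)" by (rule finite_points_below_right[OF fin])
  \<comment> \<open>In row \<open>r\<close> the new point competes as well, but all old points of
    that row are left of column \<open>c\<close>.\<close>
  have Min_right: "Min (points_right T' (x, g y)) = g (Min (points_right T p))" if ne: "points_right T p \<noteq> {}"
  proof -
    have *: "g (Min (points_right T p)) = Min (g ` points_right T p)"
      by (rule mono_Min_commute[OF g(1) finr ne])
    have "g (Min (points_right T p)) < c" if "x = r"
      using rc[of "Min (points_right T p)"] Min_points_right(2)[OF fin ne] that xy by (simp add: g_def)
    moreover have "Min (insert c (g ` points_right T p)) = min c (Min (g ` points_right T p))"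
      by (rule Min_insert) (use finr ne in auto)
    ultimately show ?thesis using * unfolding right by (cases "x = r") (simp_all add: min_def)
  qed
  have L: "forget_labels (subtree_at T' (Min (points_below T p), g y)) =
      graft (RowEnd r) (subtree_at T (Min (points_below T p), y))" if "points_below T p \<noteq> {}"
    using step.IH(1)[OF that] Min_points_below(2)[OF fin that] by (simp add: xy sh del: shift_cell.simps)
  have R: "forget_labels (subtree_at T' (x, g (Min (points_right T p)))) =
      graft (RowEnd r) (subtree_at T (x, Min (points_right T p)))" if "points_right T p \<noteq> {}"
    using step.IH(2)[OF that] Min_points_right(2)[OF fin that] by (simp add: xy sh del: shift_cell.simps)
  show ?case
    using L R new Min_right
    by (auto simp: xy sh subtree_at_unfold[OF fin', of "(x, g y)"] subtree_at_unfold[OF fin, of "(x, y)"]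
          subtree_at_neq_Leaf[OF fin] below[unfolded xy] right[unfolded xy] simp del: shift_cell.simps)
qed

lemma subtree_at_insert_line:
  assumes T: "tree_like_tableau T" and e: "valid_edge (cells T) e" and p: "p \<in> points T"
  shows "forget_labels (subtree_at (insert_line T e) (shift_cell (cells T) e p)) = graft e (subtree_at T p)"
proof (cases e)
  case (RowEnd r)
  then show ?thesis using subtree_at_insert_row_end[OF T _ p] e by simp
next
  case (ColBottom c)
  then have fe: "RowEnd c = flip_edge e" by simp
  have fin: "finite (points (insert_line T e))" using tltD(4) insert_line_tlt[OF T e] by blast
  have "(c, 0) \<in> cells (flip T)" "prod.swap p \<in> points (flip T)" using e p ColBottom by (auto simp: mem_swap)
  from subtree_at_insert_row_end[OF tlt_flip[OF T] this]
  have "forget_labels (subtree_at (flip (insert_line T e)) (prod.swap (shift_cell (cells T) e p))) =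
    graft (flip_edge e) (subtree_at (flip T) (prod.swap p))"
    unfolding fe by (simp add: insert_line_flip shift_cell_flip)
  then have "mirror (forget_labels (subtree_at (insert_line T e) (shift_cell (cells T) e p))) =
     mirror (graft e (subtree_at T p))"
    by (simp add: subtree_at_flip[OF fin] subtree_at_flip[OF tltD(4)[OF T]] graft_flip
       forget_labels_mirror forget_labels_map)
  then show ?thesis by (metis mirror_mirror)
qed

lemma tableau_tree_insert_line:
  assumes T: "tree_like_tableau T" and k: "k \<le> card (points T)"
  defines "e \<equiv> leaf_edges (tableau_point_tree T) ! k"
  shows "valid_edge (cells T) e"
    and "tableau_tree (insert_line T e) = replace_leaf k (Node Leaf () Leaf) (tableau_tree T)"
proof -
  let ?t = "tableau_point_tree T"
  have t: "?t \<noteq> Leaf" using subtree_at_neq_Leaf[OF tltD(4)[OF T]] by (simp add: tableau_point_tree_def)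
  have "e \<in> set (leaf_edges ?t)"
    using k length_leaf_edges[OF t] by (simp add: e_def size_point_tree[OF T])
  then show e: "valid_edge (cells T) e" by (simp add: set_leaf_edges[OF T])
  \<comment> \<open>As \<open>e\<close> exists, its row or column is nonempty, so the inserted line
    is never the first one and the root keeps its place.\<close>
  have "shift_cell (cells T) e (0, 0) = (0, 0)"
    using e ferrersD(2)[OF tltD(1)[OF T]] ferrers_mem_col[OF tltD(1)[OF T]] by (cases e) auto
  then have "tableau_tree (insert_line T e) = graft e ?t"
    using subtree_at_insert_line[OF T e tltD(3)[OF T]]
    by (simp add: tableau_tree_def tableau_point_tree_def)
  also have "\<dots> = replace_leaf k (Node Leaf () Leaf) (tableau_tree T)"
    unfolding e_def tableau_tree_def
    by (rule graft_nth_leaf[OF _ _ t])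
      (use k distinct_leaf_edges[OF T tltD(3)[OF T]] size_point_tree[OF T] in \<open>simp_all add: tableau_point_tree_def\<close>)
  finally show "tableau_tree (insert_line T e) = replace_leaf k (Node Leaf () Leaf) (tableau_tree T)" .
qed

section \<open>Increasing trees and the bijection\<close>

lemma tableau_tree_insertpoint:
  assumes T: "tree_like_tableau T" and k: "k \<le> card (points T)"
  defines "e \<equiv> leaf_edges (tableau_point_tree T) ! k"
  shows "tableau_tree (insertpoint T e) = replace_leaf k (Node Leaf () Leaf) (tableau_tree T)"
proof -
  note e = tableau_tree_insert_line[OF T k, folded e_def]
  have "finite (points (insertpoint T e))" using tltD(4) insertpoint_tlt(1)[OF T e(1)] by blast
  then have "tableau_tree (insertpoint T e) = tableau_tree (insert_line T e)"
    unfolding tableau_tree_def tableau_point_tree_def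
    by (subst subtree_at_cong[OF _ insertpoint_tlt(3)[OF T e(1)]]) auto
  with e(2) show ?thesis by simp
qed

section \<open>Inserting the largest letter into an increasing tree\<close>

lemma size_replace_leaf: "k \<le> size t \<Longrightarrow> size (replace_leaf k s t) = size t + size s"
  by (induction t arbitrary: k) auto

text \<open>In inorder, leaf \<open>k\<close> sits between the first \<open>k\<close> letters and
  the rest.\<close>

lemma inorder_replace_leaf:
  "k \<le> size t \<Longrightarrow> inorder (replace_leaf k s t) = take k (inorder t) @ inorder s @ drop k (inorder t)"
  by (induction t arbitrary: k) (auto simp: take_Cons' drop_Cons' not_le Suc_diff_Suc less_imp_Suc_add)

lemma set_tree_replace_leaf: "set_tree (replace_leaf k s t) \<subseteq> set_tree t \<union> set_tree s"
  by (induction t arbitrary: k) auto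

lemma heap_replace_leaf:
  assumes "heap t" "\<And>x. x \<in> set_tree t \<Longrightarrow> x \<le> m"
  shows "heap (replace_leaf k (Node Leaf m Leaf) t)"
  using assms
proof (induction t arbitrary: k)
  case (Node l x r)
  then show ?case
    using set_tree_replace_leaf[of k "Node Leaf m Leaf" l]
      set_tree_replace_leaf[of "k - Suc (size l)" "Node Leaf m Leaf" r] by fastforce
qed simp

lemma forget_labels_replace_leaf:
  "forget_labels (replace_leaf k s t) = replace_leaf k (forget_labels s) (forget_labels t)"
  by (induction t arbitrary: k) auto

text \<open>The root is the least label, and in a distinct word that letter splits the rest in only
  one way.\<close>

lemma heap_inorder_unique:
  fixes s t :: "'a::linorder tree"
  assumes "heap s" "heap t" "distinct (inorder s)" "inorder s = inorder t"
  shows "s = t"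
  using assms
proof (induction s arbitrary: t)
  case Leaf
  then show ?case by (cases t) auto
next
  case (Node l x r)
  obtain l' x' r' where t: "t = Node l' x' r'" using Node.prems(4) by (cases t) auto
  have "set (inorder (Node l x r)) = set (inorder t)" using Node.prems(4) by simp
  then have *: "insert x (set_tree l \<union> set_tree r) = insert x' (set_tree l' \<union> set_tree r')" by (simp add: t)
  have "x \<le> x'" using Node.prems(1) * by auto
  moreover have "x' \<le> x" using Node.prems(2) * by (auto simp: t)
  ultimately have x: "x' = x" by simp
  have "inorder l @ x # inorder r = inorder l' @ x # inorder r'" using Node.prems(4) by (simp add: t x)
  moreover have "x \<notin> set (inorder l)" "x \<notin> set (inorder r)" using Node.prems(3) by auto
  ultimately have "inorder l = inorder l' \<and> inorder r = inorder r'"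
    using append_Cons_eq_iff by metis
  then show ?case using Node.IH[of l'] Node.IH(2)[of r'] Node.prems(1-3) Node.prems(2)[unfolded t] by (simp add: t x)
qed

lemma permutations_Suc:
  assumes "\<tau> \<in> permutations_of_set {1..n}"
  shows "take k \<tau> @ Suc n # drop k \<tau> \<in> permutations_of_set {1..Suc n}"
proof -
  have \<tau>: "set \<tau> = {1..n}" "distinct \<tau>" using assms by (auto dest: permutations_of_setD)
  have "set (take k \<tau> @ Suc n # drop k \<tau>) = insert (Suc n) (set (take k \<tau> @ drop k \<tau>))"
    unfolding set_append list.set by blast
  also have "\<dots> = {1..Suc n}" unfolding append_take_drop_id \<tau> by auto
  finally have s: "set (take k \<tau> @ Suc n # drop k \<tau>) = {1..Suc n}" .
  have "distinct (take k \<tau> @ drop k \<tau>)" "Suc n \<notin> set (take k \<tau> @ drop k \<tau>)"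
    unfolding append_take_drop_id \<tau> using \<tau> by auto
  then have "distinct (take k \<tau> @ Suc n # drop k \<tau>)"
    unfolding distinct_append distinct.simps set_append list.set by blast
  with s show ?thesis by (rule permutations_of_setI)
qed

lemma permutations_Suc_cases:
  assumes "\<sigma> \<in> permutations_of_set {1..Suc n}"
  obtains \<tau> k where "\<tau> \<in> permutations_of_set {1..n}" "k \<le> n" "\<sigma> = take k \<tau> @ Suc n # drop k \<tau>"
proof -
  have \<sigma>: "set \<sigma> = {1..Suc n}" "distinct \<sigma>" using assms by (auto dest: permutations_of_setD)
  then have "Suc n \<in> set \<sigma>" by simp
  then obtain xs ys where xy: "\<sigma> = xs @ Suc n # ys" by (meson split_list)
  have "set (xs @ ys) = set \<sigma> - {Suc n}" using \<sigma>(2) xy by auto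
  also have "\<dots> = {1..n}" unfolding \<sigma>(1) by (auto simp: le_Suc_eq)
  finally have "set (xs @ ys) = {1..n}" .
  moreover have "distinct (xs @ ys)" using \<sigma>(2) xy by auto
  ultimately have \<tau>: "xs @ ys \<in> permutations_of_set {1..n}" by (rule permutations_of_setI)
  then have "length (xs @ ys) = n" using length_finite_permutations_of_set by fastforce
  then show thesis using that[OF \<tau>, of "length xs"] xy by simp
qed

lemma increasing_tree_unique:
  assumes "increasing_tree n s" "increasing_tree n t" "inorder s = inorder t"
  shows "s = t"
  using assms by (intro heap_inorder_unique) (auto simp: increasing_tree_def)

lemma increasing_tree_replace_leaf:
  assumes t: "increasing_tree n t" and k: "k \<le> n"
  shows "increasing_tree (Suc n) (replace_leaf k (Node Leaf (Suc n) Leaf) t)"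
proof -
  let ?s = "replace_leaf k (Node Leaf (Suc n) Leaf) t"
  have t: "size t = n" "distinct (inorder t)" "set_tree t = {1..n}" "heap t"
    using t by (auto simp: increasing_tree_def)
  have "inorder t \<in> permutations_of_set {1..n}" by (rule permutations_of_setI) (use t in auto)
  then have "inorder ?s \<in> permutations_of_set {1..Suc n}"
    using permutations_Suc k t(1) by (simp add: inorder_replace_leaf)
  then have "set_tree ?s = {1..Suc n}" "distinct (inorder ?s)"
    using permutations_of_setD[of "inorder ?s"] by auto
  moreover have "heap ?s" by (rule heap_replace_leaf) (use t in auto)
  ultimately show ?thesis using k t by (simp add: increasing_tree_def size_replace_leaf)
qed

lemma inctree_eqI:
  assumes "increasing_tree n t" "inorder t = \<sigma>"
  shows "inctree \<sigma> = t"
proof -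
  have "length \<sigma> = n" using assms by (auto simp: increasing_tree_def)
  then show ?thesis
    unfolding inctree_def using assms increasing_tree_unique by (intro the_equality) auto
qed

text \<open>Existence follows the recursion of \<open>Phi2\<close>: the largest letter is put at a
  leaf of the tree of the shorter word.\<close>

lemma inctree:
  assumes "\<sigma> \<in> permutations_of_set {1..n}"
  shows "increasing_tree n (inctree \<sigma>) \<and> inorder (inctree \<sigma>) = \<sigma>"
  using assms
proof (induction n arbitrary: \<sigma>)
  case 0
  then have "increasing_tree 0 Leaf" "inorder Leaf = \<sigma>" by (auto simp: increasing_tree_def)
  then show ?case using inctree_eqI by metis
next
  case (Suc n)
  obtain \<tau> k where \<tau>: "\<tau> \<in> permutations_of_set {1..n}" "k \<le> n" "\<sigma> = take k \<tau> @ Suc n # drop k \<tau>"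
    using permutations_Suc_cases[OF Suc.prems] .
  have t: "increasing_tree n (inctree \<tau>)" "inorder (inctree \<tau>) = \<tau>" using Suc.IH[OF \<tau>(1)] by auto
  let ?s = "replace_leaf k (Node Leaf (Suc n) Leaf) (inctree \<tau>)"
  have "increasing_tree (Suc n) ?s" by (rule increasing_tree_replace_leaf[OF t(1) \<tau>(2)])
  moreover have "inorder ?s = \<sigma>"
    using t \<tau> by (simp add: inorder_replace_leaf increasing_tree_def)
  ultimately show ?case using inctree_eqI by metis
qed

lemma perm_tree_Suc:
  assumes "\<tau> \<in> permutations_of_set {1..n}" "k \<le> n"
  shows "perm_tree (take k \<tau> @ Suc n # drop k \<tau>) = replace_leaf k (Node Leaf () Leaf) (perm_tree \<tau>)"
proof -
  have t: "increasing_tree n (inctree \<tau>)" "inorder (inctree \<tau>) = \<tau>" using inctree[OF assms(1)] by auto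
  have "inctree (take k \<tau> @ Suc n # drop k \<tau>) = replace_leaf k (Node Leaf (Suc n) Leaf) (inctree \<tau>)"
    using increasing_tree_replace_leaf[OF t(1) assms(2)]
    by (rule inctree_eqI) (use t assms(2) in \<open>simp add: inorder_replace_leaf increasing_tree_def\<close>)
  then show ?thesis by (simp add: perm_tree_def forget_labels_replace_leaf)
qed

text \<open>The \<open>k\<close> letters before the maximum give its 0-based leaf index. The bound
  \<open>n \<ge> 1\<close> leads past the base case of \<open>Phi2\<close>, which covers all words
  of length at most 1.\<close>

lemma Phi2_Suc:
  assumes \<tau>: "\<tau> \<in> permutations_of_set {1..n}" and n: "n \<ge> 1" and k: "k \<le> n"
  shows "Phi2 (take k \<tau> @ Suc n # drop k \<tau>) =
    insertpoint (Phi2 \<tau>) (leaf_edges (tableau_point_tree (Phi2 \<tau>)) ! k)"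
proof -
  let ?\<sigma> = "take k \<tau> @ Suc n # drop k \<tau>"
  have len: "length \<tau> = n" using length_finite_permutations_of_set[OF \<tau>] by simp
  have "set ?\<sigma> = {1..Suc n}" using permutations_Suc[OF \<tau>] permutations_of_setD(1) by blast
  then have m: "Max (set ?\<sigma>) = Suc n" by (simp add: Max_eq_iff)
  have notin: "Suc n \<notin> set (take k \<tau>)" using \<tau> by (auto dest!: permutations_of_setD(1) in_set_takeD)
  then have "takeWhile (\<lambda>x. x \<noteq> Suc n) ?\<sigma> = take k \<tau>" by (simp add: takeWhile_append)
  moreover have "remove1 (Suc n) ?\<sigma> = \<tau>" using notin by (simp add: remove1_append)
  moreover have "length ?\<sigma> = Suc n" using len k by simp
  then have "\<not> length ?\<sigma> \<le> 1" using n by linarith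
  ultimately show ?thesis
    using k len m by (subst Phi2.simps) (simp add: Let_def)
qed

section \<open>The tableau of size 1 and the induction\<close>

lemma tlt_size_1:
  "tree_like_tableau T \<and> tableau_size T = 1 \<longleftrightarrow> T = Tableau {(0, 0)} {(0, 0)}"
proof
  assume T: "tree_like_tableau T \<and> tableau_size T = 1"
  then have D: "tree_like_tableau T" "card (points T) = 1" by (auto simp: tableau_size_def)
  have p: "points T = {(0, 0)}" using D(2) tltD(3)[OF D(1)] by (metis card_1_singletonE singletonD)
  have "(i, j) = (0, 0)" if "(i, j) \<in> cells T" for i j
    using tltD(6,7)[OF D(1) that] p by auto
  then have "cells T = {(0, 0)}" using tltD(2)[OF D(1)] p by auto
  then show "T = Tableau {(0, 0)} {(0, 0)}" using p by (simp add: tableau.expand)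
next
  assume "T = Tableau {(0, 0)} {(0, 0)}"
  then show "tree_like_tableau T \<and> tableau_size T = 1"
    by (auto simp: tableau_size_def intro!: tltI ferrersI)
qed

lemma permutations_1: "permutations_of_set {1..1::nat} = {[1]}"
  by (simp add: permutations_of_set_singleton)

lemma perm_tree_1: "perm_tree [1] = Node Leaf () Leaf"
proof -
  have "inctree [1] = Node Leaf 1 Leaf"
    by (rule inctree_eqI[of 1]) (auto simp: increasing_tree_def)
  then show ?thesis by (simp add: perm_tree_def)
qed

lemma tableau_tree_1: "tableau_tree (Tableau {(0, 0)} {(0, 0)}) = Node Leaf () Leaf"
  by (simp add: tableau_tree_def tableau_point_tree_def subtree_at_unfold points_below_def points_right_def)

theorem theorem4p3:
  fixes n :: nat
  assumes "n \<ge> 1"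
  shows "bij_betw Phi2 (permutations_of_set {1..n})
           {T. tree_like_tableau T \<and> tableau_size T = n} \<and>
         (\<forall>\<sigma> \<in> permutations_of_set {1..n}. perm_tree \<sigma> = tableau_tree (Phi2 \<sigma>))"
  using assms
proof (induction n rule: nat_induct_at_least)
  case base
  have "Phi2 [1] = Tableau {(0, 0)} {(0, 0)}" by (simp add: Phi2.simps)
  then show ?case
    unfolding tlt_size_1 permutations_1 by (simp add: bij_betw_def perm_tree_1[simplified] tableau_tree_1)
next
  case (Suc n)
  let ?ins = "\<lambda>k \<tau>. take k \<tau> @ Suc n # drop k \<tau>"
  let ?e = "\<lambda>k \<tau>. leaf_edges (tableau_point_tree (Phi2 \<tau>)) ! k"
  have bij: "bij_betw Phi2 (permutations_of_set {1..n}) {T. tree_like_tableau T \<and> tableau_size T = n}"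
    and tree: "\<And>\<tau>. \<tau> \<in> permutations_of_set {1..n} \<Longrightarrow> perm_tree \<tau> = tableau_tree (Phi2 \<tau>)"
    using Suc.IH by auto
  have \<tau>: "tree_like_tableau (Phi2 \<tau>)" "card (points (Phi2 \<tau>)) = n" if "\<tau> \<in> permutations_of_set {1..n}" for \<tau>
    using bij_betwE[OF bij] that by (auto simp: tableau_size_def)
  have valid: "valid_edge (cells (Phi2 \<tau>)) (?e k \<tau>)" if "\<tau> \<in> permutations_of_set {1..n}" "k \<le> n" for \<tau> k
    using tableau_tree_insert_line(1)[OF \<tau>(1)] \<tau>(2) that by simp
  have length_e: "length (leaf_edges (tableau_point_tree (Phi2 \<tau>))) = Suc n"
    and distinct_e: "distinct (leaf_edges (tableau_point_tree (Phi2 \<tau>)))"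
    if "\<tau> \<in> permutations_of_set {1..n}" for \<tau>
    using \<tau>[OF that] size_point_tree[of "Phi2 \<tau>"] length_leaf_edges[of "tableau_point_tree (Phi2 \<tau>)"]
      distinct_leaf_edges[of "Phi2 \<tau>"] tltD(3,4)[of "Phi2 \<tau>"] subtree_at_neq_Leaf[of "Phi2 \<tau>"]
    by (simp_all add: tableau_point_tree_def)
  have "inj_on Phi2 (permutations_of_set {1..Suc n})"
  proof (rule inj_onI)
    fix \<sigma>1 \<sigma>2
    assume s: "\<sigma>1 \<in> permutations_of_set {1..Suc n}" "\<sigma>2 \<in> permutations_of_set {1..Suc n}"
      and eq: "Phi2 \<sigma>1 = Phi2 \<sigma>2"
    obtain \<tau>1 k1 where 1: "\<tau>1 \<in> permutations_of_set {1..n}" "k1 \<le> n" "\<sigma>1 = ?ins k1 \<tau>1"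
      using permutations_Suc_cases[OF s(1)] .
    obtain \<tau>2 k2 where 2: "\<tau>2 \<in> permutations_of_set {1..n}" "k2 \<le> n" "\<sigma>2 = ?ins k2 \<tau>2"
      using permutations_Suc_cases[OF s(2)] .
    have "insertpoint (Phi2 \<tau>1) (?e k1 \<tau>1) = insertpoint (Phi2 \<tau>2) (?e k2 \<tau>2)"
      using eq Phi2_Suc[OF 1(1) Suc.hyps 1(2)] Phi2_Suc[OF 2(1) Suc.hyps 2(2)] by (simp add: 1 2)
    then have *: "Phi2 \<tau>1 = Phi2 \<tau>2 \<and> ?e k1 \<tau>1 = ?e k2 \<tau>2"
      using insertpoint_inj \<tau>(1) valid 1 2 by metis
    then have t: "\<tau>1 = \<tau>2" using bij 1 2 by (meson bij_betw_imp_inj_on inj_onD)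
    \<comment> \<open>Both indices point to the same edge in one distinct list of leaves.\<close>
    then have "k1 = k2"
      using * distinct_e[OF 1(1)] length_e[OF 1(1)] 1(2) 2(2) by (simp add: nth_eq_iff_index_eq)
    with t show "\<sigma>1 = \<sigma>2" using 1 2 by simp
  qed
  moreover have "Phi2 ` permutations_of_set {1..Suc n} = {T. tree_like_tableau T \<and> tableau_size T = Suc n}"
  proof (intro equalityI subsetI)
    fix U assume "U \<in> Phi2 ` permutations_of_set {1..Suc n}"
    then obtain \<sigma> where s: "\<sigma> \<in> permutations_of_set {1..Suc n}" "U = Phi2 \<sigma>" by blast
    obtain t k where t: "t \<in> permutations_of_set {1..n}" "k \<le> n" "\<sigma> = ?ins k t"
      using permutations_Suc_cases[OF s(1)] .
    then have "U = insertpoint (Phi2 t) (?e k t)" using s Phi2_Suc[OF t(1) Suc.hyps t(2)] by simp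
    then show "U \<in> {T. tree_like_tableau T \<and> tableau_size T = Suc n}"
      using insertpoint_tlt(1,2)[OF \<tau>(1)[OF t(1)] valid[OF t(1,2)]] \<tau>(2)[OF t(1)]
      by (simp add: tableau_size_def)
  next
    fix U assume "U \<in> {T. tree_like_tableau T \<and> tableau_size T = Suc n}"
    then have U: "tree_like_tableau U" "card (points U) = Suc n" by (auto simp: tableau_size_def)
    then obtain T e where T: "tree_like_tableau T" "valid_edge (cells T) e" "insertpoint T e = U"
      using insertpoint_surj[of U] Suc.hyps by (metis Suc_le_mono numeral_2_eq_2 One_nat_def)
    then have "card (points T) = n" using insertpoint_tlt(2)[OF T(1,2)] U by simp
    then have "T \<in> Phi2 ` permutations_of_set {1..n}"
      using T bij_betw_imp_surj_on[OF bij] by (simp add: tableau_size_def)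
    then obtain t where t: "t \<in> permutations_of_set {1..n}" "T = Phi2 t" by blast
    \<comment> \<open>As a boundary edge of \<open>T\<close>, \<open>e\<close> occurs among the
      \<open>Suc n\<close> leaves; its index is the position for the new letter.\<close>
    obtain k where k: "k < Suc n" "?e k t = e"
      using set_leaf_edges[OF T(1), of e] T(2) length_e[OF t(1)] t by (metis in_set_conv_nth)
    have "Phi2 (?ins k t) = U" using Phi2_Suc[OF t(1) Suc.hyps] k T(3) t by simp
    then show "U \<in> Phi2 ` permutations_of_set {1..Suc n}" using permutations_Suc[OF t(1)] by blast
  qed
  moreover have "perm_tree \<sigma> = tableau_tree (Phi2 \<sigma>)" if s: "\<sigma> \<in> permutations_of_set {1..Suc n}" for \<sigma>
  proof -
    obtain t k where t: "t \<in> permutations_of_set {1..n}" "k \<le> n" "\<sigma> = ?ins k t"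
      using permutations_Suc_cases[OF s] .
    have "tableau_tree (Phi2 \<sigma>) = replace_leaf k (Node Leaf () Leaf) (tableau_tree (Phi2 t))"
      unfolding t(3) Phi2_Suc[OF t(1) Suc.hyps t(2)]
      by (rule tableau_tree_insertpoint) (use \<tau>[OF t(1)] t(2) in auto)
    then show ?thesis using perm_tree_Suc[OF t(1,2)] tree[OF t(1)] t(3) by simp
  qed
  ultimately show ?case by (simp add: bij_betw_def)
qed

end
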